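(* Let $d\in\mathbb N$, $1\le p<\infty$, $1\le v<\infty$, and let $Y_1,Y_2,\dots$ be i.i.d. with law $P_0\in\mathcal P_d$. Suppose $k_n=n^{1/(2v)}$ if $d\le 2v$ and $k_n=n^{1/d}$ if $d>2v$, $K_n=\lceil\log_2k_n\rceil$, $b_n=2^{K_n}$, and that $\alpha_{\mathbf j,b_n}>0$ for every $n\in\mathbb N$ and $\mathbf j\in[b_n]^d$. Let $\gamma>1$ and let constants satisfy $$C_1(d,v)\ge\frac{2^{d/2-v}}{1-2^{d/2-v}}\ (d<2v),\quad C_2(d,v)\ge\frac{2}{d\log 2}\ (d=2v),\quad C_3(d,v)\ge\frac{2^{2(d/2-v)}}{2^{d/2-v}-1}\ (d>2v),$$ and $C_{3+i}(d,v)>\tfrac12 C_i(d,v)^{1/v}2^{1/v}d^{1/p}$ for $i=1,2,3$. Define $$\tau_n(d,v)=\begin{cases} C_4(d,v)\,n^{-1/(2v)}\log^{\gamma/v}(n) & d<2v,\\ C_5(d,v)\,n^{-1/(2v)}\log^{(1+\gamma)/v}(n)& d=2v,\\ C_6(d,v)\,n^{-1/d}\log^{\gamma/v}(n) & d>2v.\end{cases}$$ Then $$\mathbb E_{P_0}\,\Pi_n\big(P\in\mathcal P_d: W_v(P,\bar P_n)\ge\tau_n(d,v)\big)\to0\quad\text{as }n\to\infty.$$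
   Context: The space is $[0,1)^d$ with metric $\|x-y\|_p=(\sum_{i=1}^d|x_i-y_i|^p)^{1/p}$; $\mathcal P_d$ denotes the set of Borel probability measures on $[0,1)^d$. For $\mu,\nu\in\mathcal P_d$, $W_v(\mu,\nu)=\big(\inf_{\pi}\int\|x-y\|_p^v\,d\pi(x,y)\big)^{1/v}$, the infimum over couplings $\pi$ of $\mu$ and $\nu$. For $b\in\mathbb N$ write $[b]=\{1,\dots,b\}$ and, for $\mathbf i=(i_1,\dots,i_d)\in[b]^d$, $A_{\mathbf i,b}=\prod_{l=1}^d\big[\tfrac{i_l-1}{b},\tfrac{i_l}{b}\big)$. For a probability vector $\boldsymbol\pi=(\pi_{\mathbf i})_{\mathbf i\in[b]^d}$, $\psi_b(\boldsymbol\pi)$ is the probability measure with Lebesgue density $\sum_{\mathbf i} b^d\pi_{\mathbf i}\mathbb I(y\in A_{\mathbf i,b})$. Model: $Y_1,\dots,Y_n\mid\boldsymbol\pi\overset{iid}\sim\psi_{b_n}(\boldsymbol\pi)$, $\boldsymbol\pi\sim\mathrm{Dirichlet}((\alpha_{\mathbf i,b_n})_{\mathbf i\in[b_n]^d})$. Posterior concentrations $\alpha^*_{\mathbf i,b_n}=\alpha_{\mathbf i,b_n}+\sum_{t=1}^n\mathbb I(Y_t\in A_{\mathbf i,b_n})$; the posterior $\Pi_n(\cdot\mid Y_1,\dots,Y_n)$ on $\mathcal P_d$ is the law of $\psi_{b_n}(\boldsymbol\pi)$ when $\boldsymbol\pi\sim\mathrm{Dirichlet}((\alpha^*_{\mathbf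 i,b_n})_{\mathbf i})$. The estimator $\bar P_n=\psi_{b_n}\big((\alpha^*_{\mathbf i,b_n}/\sum_{\mathbf j}\alpha^*_{\mathbf j,b_n})_{\mathbf i}\big)$ is the posterior mean histogram. *)

theory Defs
  imports "HOL-Probability.Probability"
begin

definition idx :: "nat \<Rightarrow> ('d::finite \<Rightarrow> nat) set" where
  "idx b = PiE UNIV (\<lambda>_. {1..b})"

definition cell :: "('d::finite \<Rightarrow> nat) \<Rightarrow> nat \<Rightarrow> (real^'d) set" where
  "cell i b = {y. \<forall>l. real (i l - 1) / real b \<le> y$l \<and> y$l < real (i l) / real b}"

definition unit_cube :: "(real^'d::finite) set" where
  "unit_cube = {y. \<forall>l. 0 \<le> y$l \<and> y$l < 1}"

definition Pd :: "(real^'d::finite) measure set" where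
  "Pd = {P. prob_space P \<and> sets P = sets borel \<and> emeasure P unit_cube = 1}"

definition lp_dist :: "real \<Rightarrow> real^'d::finite \<Rightarrow> real^'d \<Rightarrow> real" where
  "lp_dist p x y = (\<Sum>l\<in>UNIV. \<bar>x$l - y$l\<bar> powr p) powr (1/p)"

definition couplings :: "(real^'d::finite) measure \<Rightarrow> (real^'d) measure \<Rightarrow> ((real^'d) \<times> (real^'d)) measure set" where
  "couplings \<mu> \<nu> = {\<pi>. sets \<pi> = sets (borel \<Otimes>\<^sub>M borel) \<and>
      distr \<pi> borel fst = \<mu> \<and> distr \<pi> borel snd = \<nu>}"

definition wasserstein :: "real \<Rightarrow> real \<Rightarrow> (real^'d::finite) measure \<Rightarrow> (real^'d) measure \<Rightarrow> real" where
  "wasserstein p v \<mu> \<nu> =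
     enn2real (INF \<pi>\<in>couplings \<mu> \<nu>. \<integral>\<^sup>+ z. ennreal (lp_dist p (fst z) (snd z) powr v) \<partial>\<pi>) powr (1/v)"

definition psi :: "nat \<Rightarrow> (('d::finite \<Rightarrow> nat) \<Rightarrow> real) \<Rightarrow> (real^'d) measure" where
  "psi b \<pi> = density lborel
     (\<lambda>y. ennreal (\<Sum>i\<in>idx b. real b ^ CARD('d) * \<pi> i * indicator (cell i b) y))"

definition gamma_dist :: "real \<Rightarrow> real measure" where
  "gamma_dist a = density lborel
     (\<lambda>x. ennreal (if 0 < x then x powr (a - 1) * exp (- x) / Gamma a else 0))"

definition dirichlet :: "'i set \<Rightarrow> ('i \<Rightarrow> real) \<Rightarrow> ('i \<Rightarrow> real) measure" where
  "dirichlet I \<alpha> = distr (PiM I (\<lambda>i. gamma_dist (\<alpha> i))) (PiM I (\<lambda>_. borel))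
     (\<lambda>G. restrict (\<lambda>i. G i / (\<Sum>j\<in>I. G j)) I)"

definition post_conc :: "(('d::finite \<Rightarrow> nat) \<Rightarrow> real) \<Rightarrow> nat \<Rightarrow> (nat \<Rightarrow> real^'d) \<Rightarrow> nat
     \<Rightarrow> ('d \<Rightarrow> nat) \<Rightarrow> real" where
  "post_conc \<alpha> b Y n = (\<lambda>i. \<alpha> i + real (card {t\<in>{1..n}. Y t \<in> cell i b}))"

definition post_mean :: "(('d::finite \<Rightarrow> nat) \<Rightarrow> real) \<Rightarrow> nat \<Rightarrow> (nat \<Rightarrow> real^'d) \<Rightarrow> nat
     \<Rightarrow> (real^'d) measure" where
  "post_mean \<alpha> b Y n =
     psi b (\<lambda>i. post_conc \<alpha> b Y n i / (\<Sum>j\<in>idx b. post_conc \<alpha> b Y n j))"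

text \<open>Posterior probability Pi_n(P : W_v(P, bar P_n) >= tau | Y_1..Y_n): the posterior is
  the law of psi_b(pi) with pi ~ Dirichlet(alpha*).\<close>
definition post_prob :: "real \<Rightarrow> real \<Rightarrow> (('d::finite \<Rightarrow> nat) \<Rightarrow> real) \<Rightarrow> nat
     \<Rightarrow> (nat \<Rightarrow> real^'d) \<Rightarrow> nat \<Rightarrow> real \<Rightarrow> real" where
  "post_prob p v \<alpha> b Y n \<tau> =
     (let D = dirichlet (idx b) (post_conc \<alpha> b Y n)
      in measure D {\<pi> \<in> space D. wasserstein p v (psi b \<pi>) (post_mean \<alpha> b Y n) \<ge> \<tau>})"

definition k_seq :: "nat \<Rightarrow> real \<Rightarrow> nat \<Rightarrow> real" where
  "k_seq d v n = (if real d \<le> 2 * v then real n powr (1 / (2 * v)) else real n powr (1 / real d))"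

definition b_seq :: "nat \<Rightarrow> real \<Rightarrow> nat \<Rightarrow> nat" where
  "b_seq d v n = 2 ^ nat \<lceil>log 2 (k_seq d v n)\<rceil>"

definition tau :: "nat \<Rightarrow> real \<Rightarrow> real \<Rightarrow> (nat \<Rightarrow> real) \<Rightarrow> nat \<Rightarrow> real" where
  "tau d v \<gamma> C n =
     (if real d < 2 * v then C 4 * real n powr (- 1 / (2 * v)) * ln (real n) powr (\<gamma> / v)
      else if real d = 2 * v then C 5 * real n powr (- 1 / (2 * v)) * ln (real n) powr ((1 + \<gamma>) / v)
      else C 6 * real n powr (- 1 / real d) * ln (real n) powr (\<gamma> / v))"

end

theory Submission
  imports Defs
begin

text \<open>
  Conditionally on the data, the Wasserstein distance between a histogram drawn from the posterior
  and the posterior mean histogram is controlled by the dyadic bound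
  \<open>W\<^sub>v\<^sup>v \<lesssim> \<Sum>\<^sub>k 2\<^sup>-\<^sup>k\<^sup>v \<Sum>\<^sub>A \<bar>P(A) - Q(A)\<bar>\<close>, where \<open>A\<close> runs through the
  cells of side \<open>2\<^sup>-\<^sup>k\<close>; mass left unmatched inside the cells of the finest level costs only
  \<open>2\<^sup>-\<^sup>K\<^sup>v\<close>, which is of the right order. Writing the Dirichlet vector as normalised independent
  gamma variables and using only their first two moments, the expected deviations over the
  \<open>2\<^sup>k\<^sup>d\<close> cells of level \<open>k\<close> sum to at most a multiple of \<open>sqrt (2\<^sup>k\<^sup>d / n)\<close>, uniformly in the
  data, since the total posterior concentration is at least \<open>n\<close> as soon as all observations lie in
  the unit cube. Markov's inequality and the logarithmic slack in \<open>tau\<close> conclude.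
\<close>

section \<open>Couplings along a hierarchy of partitions\<close>

text \<open>The summed deviations are uniform in the data because the variance of one cell deviation
  is \<open>S * \<mu> * (1 - \<mu>)\<close>, at most \<open>S * \<mu>\<close>, and the means
  \<open>\<mu>\<close> of the cells of one level add up to one. However the data spread the mass,
  the variances sum to at most \<open>S\<close>, and Cauchy-Schwarz brings in only the number of
  cells. The comparison is with the centre of the Dirichlet law, so no bias term appears.
  Measurability is the other constraint. W_v is an infimum over couplings, and neither its
  measurability in the weights nor that of the posterior probability in the data is established. On
  the Dirichlet side the event is therefore dominated pointwise by a polynomial of degree two in the
  gamma variables, integrated exactly; on the data side almost every sample path receives the same
  deterministic bound. The resolution is the one at which the finest cell cost meets the rate:
  \<open>k powr (- v)\<close> is \<open>n powr (- 1 / 2)\<close> for \<open>d \<le> 2 * v\<close>,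
  while for larger \<open>d\<close> the number of cells is of order \<open>n\<close>.\<close>

definition cell_mass :: "'i set \<Rightarrow> ('i \<Rightarrow> 'c) \<Rightarrow> ('i \<Rightarrow> real) \<Rightarrow> 'c \<Rightarrow> real" where
  "cell_mass I f u a = (\<Sum>i | i \<in> I \<and> f i = a. u i)"

lemma cell_mass_diff:
  "cell_mass I f (\<lambda>i. u i - u' i) a = cell_mass I f u a - cell_mass I f u' a"
  by (simp add: cell_mass_def sum_subtractf)

lemma sum_cell_mass:
  assumes "finite I"
  shows "(\<Sum>a\<in>f ` I. cell_mass I f u a) = (\<Sum>i\<in>I. u i)"
  unfolding cell_mass_def using assms by (rule sum.image_gen[symmetric])

lemma cell_mass_nonneg:
  "(\<And>i. i \<in> I \<Longrightarrow> 0 \<le> u i) \<Longrightarrow> 0 \<le> cell_mass I f u a"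
  unfolding cell_mass_def by (rule sum_nonneg) auto

text \<open>A kernel supported inside the cells of \<open>f\<close> moves no mass between cells:
  over one cell both marginals are the same double sum.\<close>

lemma cell_mass_row_eq_column:
  fixes w :: "'i \<Rightarrow> 'i \<Rightarrow> real"
  assumes I: "finite I"
    and supp: "\<And>i j. i \<in> I \<Longrightarrow> j \<in> I \<Longrightarrow> f i \<noteq> f j \<Longrightarrow> w i j = 0"
  shows "cell_mass I f (\<lambda>i. \<Sum>j\<in>I. w i j) a = cell_mass I f (\<lambda>j. \<Sum>i\<in>I. w i j) a"
proof -
  let ?A = "{i. i \<in> I \<and> f i = a}"
  have *: "(\<Sum>j\<in>I. w i j) = (\<Sum>j\<in>?A. w i j)" if "i \<in> ?A" for i
  proof (intro sum.mono_neutral_right I ballI)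
    fix j assume "j \<in> I - ?A"
    then show "w i j = 0" using supp[of i j] that by auto
  qed auto
  have **: "(\<Sum>i\<in>I. w i j) = (\<Sum>i\<in>?A. w i j)" if "j \<in> ?A" for j
  proof (intro sum.mono_neutral_right I ballI)
    fix i assume "i \<in> I - ?A"
    then show "w i j = 0" using supp[of i j] that by auto
  qed auto
  have "cell_mass I f (\<lambda>i. \<Sum>j\<in>I. w i j) a = (\<Sum>i\<in>?A. \<Sum>j\<in>?A. w i j)"
    unfolding cell_mass_def by (intro sum.cong refl *)
  also have "\<dots> = (\<Sum>j\<in>?A. \<Sum>i\<in>?A. w i j)"
    by (rule sum.swap)
  also have "\<dots> = cell_mass I f (\<lambda>j. \<Sum>i\<in>I. w i j) a"
    unfolding cell_mass_def by (intro sum.cong refl **[symmetric])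
  finally show ?thesis .
qed

text \<open>Inside each cell this is the product of \<open>r\<close> and \<open>s\<close>, scaled so
  that the lighter side is used up completely. In a cell where both masses are 0 the division by
  zero yields 0, which is the right value.\<close>

definition cell_match :: "'i set \<Rightarrow> ('i \<Rightarrow> 'c) \<Rightarrow> ('i \<Rightarrow> real) \<Rightarrow> ('i \<Rightarrow> real) \<Rightarrow> 'i \<Rightarrow> 'i \<Rightarrow> real" where
  "cell_match I f r s i j =
     (if f i = f j then r i * s j / max (cell_mass I f r (f i)) (cell_mass I f s (f i)) else 0)"

lemma cell_match_swap: "cell_match I f r s i j = cell_match I f s r j i"
  by (simp add: cell_match_def max.commute mult.commute)

lemma cell_match_nonneg:
  assumes "\<And>i. i \<in> I \<Longrightarrow> 0 \<le> r i" "\<And>i. i \<in> I \<Longrightarrow> 0 \<le> s i" "i \<in> I" "j \<in> I"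
  shows "0 \<le> cell_match I f r s i j"
  using assms by (simp add: cell_match_def cell_mass_nonneg le_max_iff_disj)

lemma sum_cell_match:
  assumes "finite I"
  shows "(\<Sum>j\<in>I. cell_match I f r s i j) =
    r i * cell_mass I f s (f i) / max (cell_mass I f r (f i)) (cell_mass I f s (f i))"
proof -
  let ?M = "max (cell_mass I f r (f i)) (cell_mass I f s (f i))"
  have "(\<Sum>j\<in>I. cell_match I f r s i j) = (\<Sum>j\<in>I. if f j = f i then r i / ?M * s j else 0)"
    by (intro sum.cong) (auto simp: cell_match_def)
  also have "\<dots> = (\<Sum>j | j \<in> I \<and> f j = f i. r i / ?M * s j)"
    using assms by (rule sum.inter_filter[symmetric])
  also have "\<dots> = r i / ?M * cell_mass I f s (f i)"
    by (simp add: cell_mass_def sum_distrib_left)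
  finally show ?thesis by simp
qed

lemma sum_cell_match_le:
  assumes "finite I" "\<And>i. i \<in> I \<Longrightarrow> 0 \<le> r i" "\<And>i. i \<in> I \<Longrightarrow> 0 \<le> s i" "i \<in> I"
  shows "(\<Sum>j\<in>I. cell_match I f r s i j) \<le> r i"
proof -
  let ?R = "cell_mass I f r (f i)" and ?S = "cell_mass I f s (f i)"
  have "?R \<ge> 0" "?S \<ge> 0"
    using assms by (auto intro: cell_mass_nonneg)
  then have "?S / max ?R ?S \<le> 1"
    by (simp add: divide_le_eq)
  then have "r i * (?S / max ?R ?S) \<le> r i * 1"
    using assms(2,4) by (intro mult_left_mono) auto
  then show ?thesis
    by (simp add: sum_cell_match assms)
qed

text \<open>The matched mass \<open>R * S / max R S\<close> of a cell is the minimum of its two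
  masses, also when both are 0; removing it from \<open>R\<close> leaves the positive part of
  \<open>R - S\<close>.\<close>

lemma cell_match_residual:
  assumes "finite I" "\<And>i. i \<in> I \<Longrightarrow> 0 \<le> r i" "\<And>i. i \<in> I \<Longrightarrow> 0 \<le> s i"
  shows "cell_mass I f (\<lambda>i. r i - (\<Sum>j\<in>I. cell_match I f r s i j)) a
    = max 0 (cell_mass I f r a - cell_mass I f s a)"
proof -
  let ?R = "cell_mass I f r a" and ?S = "cell_mass I f s a"
  have nn: "?R \<ge> 0" "?S \<ge> 0"
    using assms by (auto intro: cell_mass_nonneg)
  have "cell_mass I f (\<lambda>i. r i - (\<Sum>j\<in>I. cell_match I f r s i j)) a
    = ?R - cell_mass I f (\<lambda>i. \<Sum>j\<in>I. cell_match I f r s i j) a"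
    by (rule cell_mass_diff)
  also have "cell_mass I f (\<lambda>i. \<Sum>j\<in>I. cell_match I f r s i j) a = ?R * (?S / max ?R ?S)"
    unfolding cell_mass_def[of I f "\<lambda>i. \<Sum>j\<in>I. cell_match I f r s i j"]
    by (subst cell_mass_def[of I f r])
       (simp add: sum_cell_match assms sum_distrib_right sum_divide_distrib)
  also have "?R - ?R * (?S / max ?R ?S) = max 0 (?R - ?S)"
    using nn by (auto simp: max_def)
  finally show ?thesis .
qed

text \<open>Mass is matched greedily from the finest partition to the coarsest. What the cells of
  level \<open>m\<close> cannot match internally is the positive part of the difference of their masses, and
  this is all that is left to be transported across the cells of level \<open>Suc m\<close>.\<close>

lemma hierarchical_matching:
  fixes p q :: "'i \<Rightarrow> real" and c :: "'i \<Rightarrow> 'i \<Rightarrow> real" and \<epsilon> :: "nat \<Rightarrow> real"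
    and g :: "nat \<Rightarrow> 'i \<Rightarrow> 'c"
  assumes I: "finite I" and p: "\<And>i. i \<in> I \<Longrightarrow> 0 \<le> p i" and q: "\<And>i. i \<in> I \<Longrightarrow> 0 \<le> q i"
    and coarsen: "\<And>m i j. i \<in> I \<Longrightarrow> j \<in> I \<Longrightarrow> g m i = g m j \<Longrightarrow> g (Suc m) i = g (Suc m) j"
    and cost: "\<And>m i j. m \<le> K \<Longrightarrow> i \<in> I \<Longrightarrow> j \<in> I \<Longrightarrow> g m i = g m j \<Longrightarrow> c i j \<le> \<epsilon> m"
    and eps: "\<And>m. 0 \<le> \<epsilon> m"
    and "m \<le> K"
  shows "\<exists>w. (\<forall>i\<in>I. \<forall>j\<in>I. 0 \<le> w i j \<and> (g m i \<noteq> g m j \<longrightarrow> w i j = 0))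
    \<and> (\<forall>i\<in>I. (\<Sum>j\<in>I. w i j) \<le> p i) \<and> (\<forall>j\<in>I. (\<Sum>i\<in>I. w i j) \<le> q j)
    \<and> (\<forall>a. cell_mass I (g m) (\<lambda>i. p i - (\<Sum>j\<in>I. w i j)) a
          = max 0 (cell_mass I (g m) p a - cell_mass I (g m) q a))
    \<and> (\<forall>a. cell_mass I (g m) (\<lambda>j. q j - (\<Sum>i\<in>I. w i j)) a
          = max 0 (cell_mass I (g m) q a - cell_mass I (g m) p a))
    \<and> (\<Sum>i\<in>I. \<Sum>j\<in>I. w i j * c i j) \<le> \<epsilon> 0 * (\<Sum>i\<in>I. p i)
        + (\<Sum>l<m. \<epsilon> (Suc l) * (\<Sum>a\<in>g l ` I. \<bar>cell_mass I (g l) p a - cell_mass I (g l) q a\<bar>))"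
  using \<open>m \<le> K\<close>
proof (induction m)
  case 0
  let ?w = "cell_match I (g 0) p q"
  have col: "(\<Sum>i\<in>I. ?w i j) = (\<Sum>i\<in>I. cell_match I (g 0) q p j i)" for j
    by (intro sum.cong refl cell_match_swap)
  have "(\<Sum>i\<in>I. \<Sum>j\<in>I. ?w i j * c i j) \<le> (\<Sum>i\<in>I. \<Sum>j\<in>I. ?w i j * \<epsilon> 0)"
  proof (intro sum_mono)
    fix i j assume ij: "i \<in> I" "j \<in> I"
    show "?w i j * c i j \<le> ?w i j * \<epsilon> 0"
    proof (cases "g 0 i = g 0 j")
      case True
      then show ?thesis
        using cost[of 0 i j] ij by (intro mult_left_mono cell_match_nonneg p q) auto
    qed (simp add: cell_match_def)
  qed
  also have "\<dots> = \<epsilon> 0 * (\<Sum>i\<in>I. \<Sum>j\<in>I. ?w i j)"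
    by (simp add: sum_distrib_left sum_distrib_right mult.commute)
  also have "\<dots> \<le> \<epsilon> 0 * (\<Sum>i\<in>I. p i)"
    by (intro mult_left_mono sum_mono sum_cell_match_le I p q eps)
  finally have "(\<Sum>i\<in>I. \<Sum>j\<in>I. ?w i j * c i j) \<le> \<epsilon> 0 * (\<Sum>i\<in>I. p i)" .
  moreover have "0 \<le> ?w i j \<and> (g 0 i \<noteq> g 0 j \<longrightarrow> ?w i j = 0)" if "i \<in> I" "j \<in> I" for i j
    using cell_match_nonneg[of I p q i j "g 0", OF p q that] by (simp add: cell_match_def)
  ultimately show ?case
    using I p q
    by (intro exI[of _ ?w]) (auto simp: col sum_cell_match_le cell_match_residual)
next
  case (Suc m)
  then obtain w where
      w: "\<And>i j. i \<in> I \<Longrightarrow> j \<in> I \<Longrightarrow> 0 \<le> w i j"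
    and w_supp: "\<And>i j. i \<in> I \<Longrightarrow> j \<in> I \<Longrightarrow> g m i \<noteq> g m j \<Longrightarrow> w i j = 0"
    and row: "\<And>i. i \<in> I \<Longrightarrow> (\<Sum>j\<in>I. w i j) \<le> p i"
    and col: "\<And>j. j \<in> I \<Longrightarrow> (\<Sum>i\<in>I. w i j) \<le> q j"
    and res: "\<And>a. cell_mass I (g m) (\<lambda>i. p i - (\<Sum>j\<in>I. w i j)) a
          = max 0 (cell_mass I (g m) p a - cell_mass I (g m) q a)"
    and w_cost: "(\<Sum>i\<in>I. \<Sum>j\<in>I. w i j * c i j) \<le> \<epsilon> 0 * (\<Sum>i\<in>I. p i)
        + (\<Sum>l<m. \<epsilon> (Suc l) * (\<Sum>a\<in>g l ` I. \<bar>cell_mass I (g l) p a - cell_mass I (g l) q a\<bar>))"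
    using Suc_leD by blast
  let ?g = "g (Suc m)"
  define r where "r i = p i - (\<Sum>j\<in>I. w i j)" for i
  define s where "s j = q j - (\<Sum>i\<in>I. w i j)" for j
  have r: "0 \<le> r i" and s: "0 \<le> s i" if "i \<in> I" for i
    using row col that by (auto simp: r_def s_def)
  define u where "u = cell_match I ?g r s"
  have u: "0 \<le> u i j" if "i \<in> I" "j \<in> I" for i j
    unfolding u_def by (intro cell_match_nonneg r s that)
  have u_supp: "u i j = 0" if "?g i \<noteq> ?g j" for i j
    using that by (simp add: u_def cell_match_def)
  have u_col: "(\<Sum>i\<in>I. u i j) = (\<Sum>i\<in>I. cell_match I ?g s r j i)" for j
    unfolding u_def by (intro sum.cong refl cell_match_swap)
  have u_row_le: "(\<Sum>j\<in>I. u i j) \<le> r i" if "i \<in> I" for i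
    unfolding u_def by (intro sum_cell_match_le I r s that)
  have u_col_le: "(\<Sum>j\<in>I. u j i) \<le> s i" if "i \<in> I" for i
    unfolding u_col by (intro sum_cell_match_le I r s that)
  \<comment> \<open>Mass matched so far stays inside a fine cell, hence inside a coarse one, so
    passing to the residuals \<open>r\<close> and \<open>s\<close> leaves the imbalance of every
    coarse cell unchanged.\<close>
  have "cell_mass I ?g (\<lambda>i. \<Sum>j\<in>I. w i j) a = cell_mass I ?g (\<lambda>j. \<Sum>i\<in>I. w i j) a" for a
    using coarsen w_supp by (intro cell_mass_row_eq_column I) blast
  then have diff: "cell_mass I ?g r a - cell_mass I ?g s a = cell_mass I ?g p a - cell_mass I ?g q a" for a
    unfolding r_def s_def cell_mass_diff by simp
  let ?W = "\<lambda>i j. w i j + u i j"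
  have resW: "p i - (\<Sum>j\<in>I. ?W i j) = r i - (\<Sum>j\<in>I. u i j)" "q i - (\<Sum>j\<in>I. ?W j i) = s i - (\<Sum>j\<in>I. u j i)" for i
    by (simp_all add: r_def s_def sum.distrib)
  have "(\<Sum>i\<in>I. \<Sum>j\<in>I. u i j * c i j) \<le> (\<Sum>i\<in>I. \<Sum>j\<in>I. u i j * \<epsilon> (Suc m))"
  proof (intro sum_mono)
    fix i j assume ij: "i \<in> I" "j \<in> I"
    show "u i j * c i j \<le> u i j * \<epsilon> (Suc m)"
    proof (cases "?g i = ?g j")
      case True
      then show ?thesis
        using cost[of "Suc m" i j] ij Suc.prems by (intro mult_left_mono u) auto
    qed (simp add: u_supp)
  qed
  also have "\<dots> = \<epsilon> (Suc m) * (\<Sum>i\<in>I. \<Sum>j\<in>I. u i j)"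
    by (simp add: sum_distrib_left sum_distrib_right mult.commute)
  also have "\<dots> \<le> \<epsilon> (Suc m) * (\<Sum>i\<in>I. r i)"
    by (intro mult_left_mono sum_mono u_row_le eps)
  \<comment> \<open>The residual is measured on the cells of level \<open>m\<close>, although it
    moves inside those of level \<open>Suc m\<close>: this is the index shift between
    \<open>\<epsilon> (Suc l)\<close> and \<open>g l\<close>.\<close>
  also have "(\<Sum>i\<in>I. r i) = (\<Sum>a\<in>g m ` I. cell_mass I (g m) r a)"
    by (rule sum_cell_mass[OF I, symmetric])
  also have "\<dots> \<le> (\<Sum>a\<in>g m ` I. \<bar>cell_mass I (g m) p a - cell_mass I (g m) q a\<bar>)"
    unfolding r_def res by (intro sum_mono) auto
  finally have u_cost: "(\<Sum>i\<in>I. \<Sum>j\<in>I. u i j * c i j)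
      \<le> \<epsilon> (Suc m) * (\<Sum>a\<in>g m ` I. \<bar>cell_mass I (g m) p a - cell_mass I (g m) q a\<bar>)"
    using eps by (simp add: mult_left_mono)
  show ?case
  proof (intro exI[of _ ?W] conjI ballI allI impI)
    fix i j assume ij: "i \<in> I" "j \<in> I"
    show "0 \<le> ?W i j" using u w ij by simp
    assume "?g i \<noteq> ?g j"
    then have "g m i \<noteq> g m j" using coarsen[OF ij] by blast
    then show "?W i j = 0" using u_supp[OF \<open>?g i \<noteq> ?g j\<close>] w_supp[OF ij] by simp
  next
    fix i assume "i \<in> I"
    then show "(\<Sum>j\<in>I. ?W i j) \<le> p i" "(\<Sum>j\<in>I. ?W j i) \<le> q i"
      using u_row_le[of i] u_col_le[of i] resW[of i] by linarith+
  next
    fix a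
    show "cell_mass I ?g (\<lambda>i. p i - (\<Sum>j\<in>I. ?W i j)) a
          = max 0 (cell_mass I ?g p a - cell_mass I ?g q a)"
      unfolding resW unfolding u_def using I r s
      by (subst cell_match_residual) (auto simp: diff)
    show "cell_mass I ?g (\<lambda>j. q j - (\<Sum>i\<in>I. ?W i j)) a
          = max 0 (cell_mass I ?g q a - cell_mass I ?g p a)"
      unfolding resW u_col using I r s diff[of a]
      by (subst cell_match_residual) (auto simp: algebra_simps)
  next
    show "(\<Sum>i\<in>I. \<Sum>j\<in>I. ?W i j * c i j) \<le> \<epsilon> 0 * (\<Sum>i\<in>I. p i)
        + (\<Sum>l<Suc m. \<epsilon> (Suc l) * (\<Sum>a\<in>g l ` I. \<bar>cell_mass I (g l) p a - cell_mass I (g l) q a\<bar>))"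
      using w_cost u_cost by (simp add: distrib_right sum.distrib)
  qed
qed

text \<open>Level \<open>K\<close> has a single cell, in which the two totals agree, so both
  residuals sum to zero; being nonnegative they vanish, and the partial matching is a
  coupling.\<close>

lemma hierarchical_coupling:
  fixes p q :: "'i \<Rightarrow> real" and c :: "'i \<Rightarrow> 'i \<Rightarrow> real" and \<epsilon> :: "nat \<Rightarrow> real"
    and g :: "nat \<Rightarrow> 'i \<Rightarrow> 'c"
  assumes I: "finite I" and p: "\<And>i. i \<in> I \<Longrightarrow> 0 \<le> p i" and q: "\<And>i. i \<in> I \<Longrightarrow> 0 \<le> q i"
    and total: "(\<Sum>i\<in>I. p i) = (\<Sum>i\<in>I. q i)"
    and coarsen: "\<And>m i j. i \<in> I \<Longrightarrow> j \<in> I \<Longrightarrow> g m i = g m j \<Longrightarrow> g (Suc m) i = g (Suc m) j"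
    and one_cell: "\<And>i j. i \<in> I \<Longrightarrow> j \<in> I \<Longrightarrow> g K i = g K j"
    and cost: "\<And>m i j. m \<le> K \<Longrightarrow> i \<in> I \<Longrightarrow> j \<in> I \<Longrightarrow> g m i = g m j \<Longrightarrow> c i j \<le> \<epsilon> m"
    and eps: "\<And>m. 0 \<le> \<epsilon> m"
  obtains w where "\<And>i j. i \<in> I \<Longrightarrow> j \<in> I \<Longrightarrow> 0 \<le> w i j"
    "\<And>i. i \<in> I \<Longrightarrow> (\<Sum>j\<in>I. w i j) = p i" "\<And>j. j \<in> I \<Longrightarrow> (\<Sum>i\<in>I. w i j) = q j"
    "(\<Sum>i\<in>I. \<Sum>j\<in>I. w i j * c i j) \<le> \<epsilon> 0 * (\<Sum>i\<in>I. p i)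
      + (\<Sum>l<K. \<epsilon> (Suc l) * (\<Sum>a\<in>g l ` I. \<bar>cell_mass I (g l) p a - cell_mass I (g l) q a\<bar>))"
proof -
  obtain w where w: "\<forall>i\<in>I. \<forall>j\<in>I. 0 \<le> w i j \<and> (g K i \<noteq> g K j \<longrightarrow> w i j = 0)"
    and row: "\<forall>i\<in>I. (\<Sum>j\<in>I. w i j) \<le> p i" and col: "\<forall>j\<in>I. (\<Sum>i\<in>I. w i j) \<le> q j"
    and res: "\<forall>a. cell_mass I (g K) (\<lambda>i. p i - (\<Sum>j\<in>I. w i j)) a
          = max 0 (cell_mass I (g K) p a - cell_mass I (g K) q a)"
      "\<forall>a. cell_mass I (g K) (\<lambda>j. q j - (\<Sum>i\<in>I. w i j)) a
          = max 0 (cell_mass I (g K) q a - cell_mass I (g K) p a)"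
    and w_cost: "(\<Sum>i\<in>I. \<Sum>j\<in>I. w i j * c i j) \<le> \<epsilon> 0 * (\<Sum>i\<in>I. p i)
      + (\<Sum>l<K. \<epsilon> (Suc l) * (\<Sum>a\<in>g l ` I. \<bar>cell_mass I (g l) p a - cell_mass I (g l) q a\<bar>))"
    using hierarchical_matching[where p = p and q = q and g = g and c = c and \<epsilon> = \<epsilon> and K = K and m = K,
        OF I p q coarsen cost eps order_refl] by blast
  have all: "cell_mass I (g K) u (g K i) = sum u I" if "i \<in> I" for u i
  proof -
    have "{j. j \<in> I \<and> g K j = g K i} = I" using one_cell[OF _ that] by blast
    then show ?thesis by (simp add: cell_mass_def)
  qed
  have "(\<Sum>j\<in>I. w i j) = p i" "(\<Sum>j\<in>I. w j i) = q i" if i: "i \<in> I" for i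
  proof -
    have "sum (\<lambda>i. p i - (\<Sum>j\<in>I. w i j)) I = 0" "sum (\<lambda>j. q j - (\<Sum>i\<in>I. w i j)) I = 0"
      using res[THEN spec, of "g K i"] unfolding all[OF i] total by simp_all
    then have "\<forall>i\<in>I. p i - (\<Sum>j\<in>I. w i j) = 0" "\<forall>j\<in>I. q j - (\<Sum>i\<in>I. w i j) = 0"
      using row col by (subst (asm) sum_nonneg_eq_0_iff[OF I]; simp)+
    with i show "(\<Sum>j\<in>I. w i j) = p i" "(\<Sum>j\<in>I. w j i) = q i" by simp_all
  qed
  with that w w_cost show thesis by blast
qed

section \<open>Wasserstein distance of histograms\<close>

lemma finite_idx [simp]: "finite (idx b :: ('d::finite \<Rightarrow> nat) set)"
  unfolding idx_def by (intro finite_PiE) auto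

lemma sets_cell [measurable]: "cell i b \<in> sets (borel :: (real^'d::finite) measure)"
  unfolding cell_def by measurable

text \<open>The half-open cell is squeezed between an open and a closed box of the same
  volume.\<close>

lemma emeasure_lborel_cell:
  fixes i :: "'d::finite \<Rightarrow> nat"
  assumes i: "i \<in> idx b" and b: "0 < b"
  shows "emeasure lborel (cell i b) = ennreal (1 / real b ^ CARD('d))"
proof -
  define l :: "real^'d" where "l = (\<chi> k. real (i k - 1) / real b)"
  define u :: "real^'d" where "u = (\<chi> k. real (i k) / real b)"
  have diff: "u $ k - l $ k = 1 / real b" for k
  proof -
    \<comment> \<open>Indices start at 1, so the natural subtraction in \<open>cell\<close> is not
      truncated.\<close>
    have "1 \<le> i k" using i by (auto simp: idx_def PiE_iff)
    then show ?thesis by (simp add: u_def l_def of_nat_diff diff_divide_distrib)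
  qed
  have le: "l $ k \<le> u $ k" for k
    using diff[of k] zero_le_divide_1_iff[of "real b"] by linarith
  have "cbox l u \<noteq> {}"
    using le by (metis mem_box_cart(2) order_refl empty_iff)
  then have "measure lborel (cbox l u) = (\<Prod>k\<in>UNIV. u $ k - l $ k)"
    by (rule content_cbox_cart)
  then have c: "emeasure lborel (cbox l u) = ennreal (1 / real b ^ CARD('d))"
    using emeasure_lborel_cbox_finite[of l u]
    by (subst emeasure_eq_ennreal_measure) (auto simp: diff power_one_over)
  have "emeasure lborel (box l u) = emeasure lborel (cbox l u)"
    by (simp add: emeasure_lborel_box_eq emeasure_lborel_cbox_eq)
  moreover have "emeasure lborel (box l u) \<le> emeasure lborel (cell i b)"
    by (intro emeasure_mono) (auto simp: mem_box_cart cell_def l_def u_def less_imp_le)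
  moreover have "emeasure lborel (cell i b) \<le> emeasure lborel (cbox l u)"
    by (intro emeasure_mono) (auto simp: mem_box_cart cell_def l_def u_def less_imp_le)
  ultimately show ?thesis using c by simp
qed

lemma borel_measurable_vec_nth: "(\<lambda>x :: real^'d::finite. x $ l) \<in> borel_measurable borel"
  by (intro borel_measurable_continuous_onI continuous_intros)

lemma borel_measurable_lp_dist [measurable]:
  "(\<lambda>z. lp_dist p (fst z) (snd z)) \<in> borel_measurable (borel \<Otimes>\<^sub>M (borel :: (real^'d::finite) measure))"
proof -
  let ?B = "borel \<Otimes>\<^sub>M borel :: ((real^'d) \<times> (real^'d)) measure"
  have [measurable]: "(\<lambda>z. fst z $ l) \<in> borel_measurable ?B" "(\<lambda>z. snd z $ l) \<in> borel_measurable ?B" for l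
    by (intro measurable_compose[OF _ borel_measurable_vec_nth] measurable_fst measurable_snd)+
  show ?thesis unfolding lp_dist_def by measurable
qed

text \<open>For \<open>i \<in> idx b\<close> and \<open>b > 0\<close> this is the Lebesgue density
  of the uniform law on the cell; histograms are mixtures of these.\<close>

definition cell_density :: "nat \<Rightarrow> ('d::finite \<Rightarrow> nat) \<Rightarrow> real^'d \<Rightarrow> ennreal" where
  "cell_density b i y = ennreal (real b ^ CARD('d)) * indicator (cell i b) y"

lemma borel_measurable_cell_density [measurable]: "cell_density b i \<in> borel_measurable borel"
  unfolding cell_density_def by measurable

lemma nn_integral_cell_density:
  fixes i :: "'d::finite \<Rightarrow> nat"
  assumes "i \<in> idx b" "0 < b"
  shows "(\<integral>\<^sup>+y. cell_density b i y \<partial>lborel) = 1"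
proof -
  have "(\<integral>\<^sup>+y. cell_density b i y \<partial>lborel) = ennreal (real b ^ CARD('d)) * emeasure lborel (cell i b)"
    unfolding cell_density_def by (simp add: nn_integral_cmult)
  also have "\<dots> = 1"
    using assms by (simp add: emeasure_lborel_cell ennreal_mult[symmetric] del: ennreal_power)
  finally show ?thesis .
qed

lemma psi_eq_density:
  fixes P :: "('d::finite \<Rightarrow> nat) \<Rightarrow> real"
  assumes "\<And>i. i \<in> idx b \<Longrightarrow> 0 \<le> P i"
  shows "psi b P = density lborel (\<lambda>y. \<Sum>i\<in>idx b. ennreal (P i) * cell_density b i y)"
proof -
  have "ennreal (\<Sum>i\<in>idx b. real b ^ CARD('d) * P i * indicator (cell i b) y)
    = (\<Sum>i\<in>idx b. ennreal (P i) * cell_density b i y)" for y :: "real^'d"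
  proof -
    have "ennreal (\<Sum>i\<in>idx b. real b ^ CARD('d) * P i * indicator (cell i b) y)
      = (\<Sum>i\<in>idx b. ennreal (real b ^ CARD('d) * P i * indicator (cell i b) y))"
      using assms by (intro sum_ennreal[symmetric]) auto
    also have "\<dots> = (\<Sum>i\<in>idx b. ennreal (P i) * cell_density b i y)"
      using assms
      by (intro sum.cong refl) (auto simp: cell_density_def ennreal_mult mult.commute indicator_def)
    finally show ?thesis .
  qed
  then show ?thesis unfolding psi_def by simp
qed

text \<open>The weights \<open>w i j\<close> lift to the mixture of the products of the uniform laws
  on cells \<open>i\<close> and \<open>j\<close>. Its marginals are the two histograms because each
  uniform density integrates to one, and its cost is at most the discrete cost because
  \<open>c i j\<close> dominates the ground cost over the whole pair of cells.\<close>

lemma wasserstein_psi_le: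
  fixes P Q :: "('d::finite \<Rightarrow> nat) \<Rightarrow> real"
  assumes b: "0 < b" and v: "0 < v"
    and w: "\<And>i j. i \<in> idx b \<Longrightarrow> j \<in> idx b \<Longrightarrow> 0 \<le> w i j"
    and row: "\<And>i. i \<in> idx b \<Longrightarrow> (\<Sum>j\<in>idx b. w i j) = P i"
    and col: "\<And>j. j \<in> idx b \<Longrightarrow> (\<Sum>i\<in>idx b. w i j) = Q j"
    and c: "\<And>i j. i \<in> idx b \<Longrightarrow> j \<in> idx b \<Longrightarrow> 0 \<le> c i j"
    and cost: "\<And>i j x y. i \<in> idx b \<Longrightarrow> j \<in> idx b \<Longrightarrow> x \<in> cell i b \<Longrightarrow> y \<in> cell j b
      \<Longrightarrow> lp_dist p x y powr v \<le> c i j"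
  shows "wasserstein p v (psi b P) (psi b Q) \<le> (\<Sum>i\<in>idx b. \<Sum>j\<in>idx b. w i j * c i j) powr (1 / v)"
proof -
  let ?I = "idx b :: ('d \<Rightarrow> nat) set" and ?L = "lborel :: (real^'d) measure"
  have P: "0 \<le> P i" if "i \<in> ?I" for i using row[OF that] w[OF that] by (metis sum_nonneg)
  have Q: "0 \<le> Q j" if "j \<in> ?I" for j using col[OF that] w[OF _ that] by (metis sum_nonneg)
  have rowe: "(\<Sum>j\<in>?I. ennreal (w i j)) = ennreal (P i)" if "i \<in> ?I" for i
    using w[OF that] row[OF that] by (subst sum_ennreal) auto
  have cole: "(\<Sum>i\<in>?I. ennreal (w i j)) = ennreal (Q j)" if "j \<in> ?I" for j
    using w[OF _ that] col[OF that] by (subst sum_ennreal) auto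
  note one = nn_integral_cell_density[OF _ b]
  define g where "g z = (\<Sum>i\<in>?I. \<Sum>j\<in>?I. ennreal (w i j) * (cell_density b i (fst z) * cell_density b j (snd z)))"
    for z :: "(real^'d) \<times> (real^'d)"
  have g [measurable]: "g \<in> borel_measurable (?L \<Otimes>\<^sub>M ?L)"
    unfolding g_def by measurable
  define J where "J = density (?L \<Otimes>\<^sub>M ?L) g"
  have sets_J: "sets J = sets (borel \<Otimes>\<^sub>M borel)"
    unfolding J_def by (simp cong: sets_pair_measure_cong)
  have space_J: "space J = UNIV"
    unfolding J_def by (simp add: space_pair_measure)
  have [measurable]: "fst \<in> measurable J borel" "snd \<in> measurable J borel"
    unfolding measurable_cong_sets[OF sets_J refl] by measurable
  have "distr J borel fst = psi b P"
  proof (rule measure_eqI)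
    fix A assume "A \<in> sets (distr J borel fst)"
    then have A [measurable]: "A \<in> sets borel" by simp
    have "emeasure (distr J borel fst) A = (\<integral>\<^sup>+z. g z * indicator A (fst z) \<partial>(?L \<Otimes>\<^sub>M ?L))"
    proof -
      have "emeasure (distr J borel fst) A = emeasure J (fst -` A \<inter> space J)"
        by (intro emeasure_distr) auto
      also have "\<dots> = (\<integral>\<^sup>+z. g z * indicator (fst -` A \<inter> space J) z \<partial>(?L \<Otimes>\<^sub>M ?L))"
        unfolding J_def using sets_J
        by (intro emeasure_density g) (metis A J_def \<open>fst \<in> measurable J borel\<close> measurable_sets sets_density)
      finally show ?thesis by (simp add: space_J indicator_def)
    qed
    also have "\<dots> = (\<integral>\<^sup>+x. \<integral>\<^sup>+y. g (x, y) * indicator A x \<partial>?L \<partial>?L)"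
      by (subst lborel.nn_integral_fst[symmetric]) auto
    also have "\<dots> = (\<integral>\<^sup>+x. (\<Sum>i\<in>?I. ennreal (P i) * cell_density b i x) * indicator A x \<partial>?L)"
    proof (intro nn_integral_cong)
      fix x
      have "(\<integral>\<^sup>+y. g (x, y) * indicator A x \<partial>?L)
        = (\<integral>\<^sup>+y. (\<Sum>i\<in>?I. \<Sum>j\<in>?I. (ennreal (w i j) * cell_density b i x * indicator A x) * cell_density b j y) \<partial>?L)"
        unfolding g_def sum_distrib_right by (simp only: mult_ac fst_conv snd_conv)
      also have "\<dots> = (\<Sum>i\<in>?I. \<Sum>j\<in>?I. ennreal (w i j) * cell_density b i x * indicator A x)"
        by (simp add: nn_integral_sum nn_integral_cmult one)
      also have "\<dots> = (\<Sum>i\<in>?I. ennreal (P i) * cell_density b i x) * indicator A x"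
        by (simp only: sum_distrib_left sum_distrib_right rowe[symmetric] mult_ac cong: sum.cong)
      finally show "(\<integral>\<^sup>+y. g (x, y) * indicator A x \<partial>?L) = (\<Sum>i\<in>?I. ennreal (P i) * cell_density b i x) * indicator A x" .
    qed
    also have "\<dots> = emeasure (psi b P) A"
      using P by (subst psi_eq_density) (auto simp: emeasure_density)
    finally show "emeasure (distr J borel fst) A = emeasure (psi b P) A" .
  qed (simp add: psi_def)
  moreover have "distr J borel snd = psi b Q"
  proof (rule measure_eqI)
    fix A assume "A \<in> sets (distr J borel snd)"
    then have A [measurable]: "A \<in> sets borel" by simp
    have "emeasure (distr J borel snd) A = (\<integral>\<^sup>+z. g z * indicator A (snd z) \<partial>(?L \<Otimes>\<^sub>M ?L))"
    proof -
      have "emeasure (distr J borel snd) A = emeasure J (snd -` A \<inter> space J)"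
        by (intro emeasure_distr) auto
      also have "\<dots> = (\<integral>\<^sup>+z. g z * indicator (snd -` A \<inter> space J) z \<partial>(?L \<Otimes>\<^sub>M ?L))"
        unfolding J_def using sets_J
        by (intro emeasure_density g) (metis A J_def \<open>snd \<in> measurable J borel\<close> measurable_sets sets_density)
      finally show ?thesis by (simp add: space_J indicator_def)
    qed
    also have "\<dots> = (\<integral>\<^sup>+y. \<integral>\<^sup>+x. g (x, y) * indicator A y \<partial>?L \<partial>?L)"
      by (subst lborel_pair.nn_integral_snd[symmetric]) (auto simp: split_beta')
    also have "\<dots> = (\<integral>\<^sup>+y. (\<Sum>j\<in>?I. ennreal (Q j) * cell_density b j y) * indicator A y \<partial>?L)"
    proof (intro nn_integral_cong)
      fix y
      have "(\<integral>\<^sup>+x. g (x, y) * indicator A y \<partial>?L)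
        = (\<integral>\<^sup>+x. (\<Sum>i\<in>?I. \<Sum>j\<in>?I. (ennreal (w i j) * cell_density b j y * indicator A y) * cell_density b i x) \<partial>?L)"
        unfolding g_def sum_distrib_right by (simp only: mult_ac fst_conv snd_conv)
      also have "\<dots> = (\<Sum>i\<in>?I. \<Sum>j\<in>?I. ennreal (w i j) * cell_density b j y * indicator A y)"
        by (simp add: nn_integral_sum nn_integral_cmult one)
      also have "\<dots> = (\<Sum>j\<in>?I. \<Sum>i\<in>?I. ennreal (w i j) * cell_density b j y * indicator A y)"
        by (rule sum.swap)
      also have "\<dots> = (\<Sum>j\<in>?I. ennreal (Q j) * cell_density b j y) * indicator A y"
        by (simp only: sum_distrib_left sum_distrib_right cole[symmetric] mult_ac cong: sum.cong)
      finally show "(\<integral>\<^sup>+x. g (x, y) * indicator A y \<partial>?L) = (\<Sum>j\<in>?I. ennreal (Q j) * cell_density b j y) * indicator A y" .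
    qed
    also have "\<dots> = emeasure (psi b Q) A"
      using Q by (subst psi_eq_density) (auto simp: emeasure_density)
    finally show "emeasure (distr J borel snd) A = emeasure (psi b Q) A" .
  qed (simp add: psi_def)
  ultimately have J: "J \<in> couplings (psi b P) (psi b Q)"
    by (simp add: couplings_def sets_J)
  have [measurable]: "(\<lambda>z. lp_dist p (fst z) (snd z)) \<in> borel_measurable (?L \<Otimes>\<^sub>M ?L)"
    using borel_measurable_lp_dist by (simp cong: measurable_cong_sets sets_pair_measure_cong)
  let ?S = "\<Sum>i\<in>?I. \<Sum>j\<in>?I. w i j * c i j"
  have "(\<integral>\<^sup>+z. ennreal (lp_dist p (fst z) (snd z) powr v) \<partial>J)
      = (\<integral>\<^sup>+z. g z * ennreal (lp_dist p (fst z) (snd z) powr v) \<partial>(?L \<Otimes>\<^sub>M ?L))"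
    unfolding J_def by (intro nn_integral_density) measurable
  also have "\<dots> \<le> (\<integral>\<^sup>+z. (\<Sum>i\<in>?I. \<Sum>j\<in>?I. ennreal (w i j) * ennreal (c i j) *
      (cell_density b i (fst z) * cell_density b j (snd z))) \<partial>(?L \<Otimes>\<^sub>M ?L))"
  proof (intro nn_integral_mono)
    fix z :: "(real^'d) \<times> (real^'d)"
    have "cell_density b i (fst z) * cell_density b j (snd z) * ennreal (lp_dist p (fst z) (snd z) powr v)
      \<le> cell_density b i (fst z) * cell_density b j (snd z) * ennreal (c i j)" if "i \<in> ?I" "j \<in> ?I" for i j
    proof (cases "fst z \<in> cell i b \<and> snd z \<in> cell j b")
      case True
      then show ?thesis using cost[OF that] by (intro mult_left_mono ennreal_leI) auto
    qed (auto simp: cell_density_def)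
    then show "g z * ennreal (lp_dist p (fst z) (snd z) powr v)
      \<le> (\<Sum>i\<in>?I. \<Sum>j\<in>?I. ennreal (w i j) * ennreal (c i j) * (cell_density b i (fst z) * cell_density b j (snd z)))"
      unfolding g_def sum_distrib_right
      by (intro sum_mono) (simp add: mult.assoc mult.left_commute[of _ "ennreal (c _ _)"] mult_left_mono mult.commute[of "ennreal (c _ _)"])
  qed
  also have "\<dots> = (\<Sum>i\<in>?I. \<Sum>j\<in>?I. ennreal (w i j) * ennreal (c i j) *
      (\<integral>\<^sup>+z. cell_density b i (fst z) * cell_density b j (snd z) \<partial>(?L \<Otimes>\<^sub>M ?L)))"
    by (simp add: nn_integral_sum nn_integral_cmult)
  also have "\<dots> = (\<Sum>i\<in>?I. \<Sum>j\<in>?I. ennreal (w i j) * ennreal (c i j))"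
  proof (intro sum.cong refl)
    fix i j assume ij: "i \<in> ?I" "j \<in> ?I"
    have "(\<integral>\<^sup>+z. cell_density b i (fst z) * cell_density b j (snd z) \<partial>(?L \<Otimes>\<^sub>M ?L))
      = (\<integral>\<^sup>+x. \<integral>\<^sup>+y. cell_density b i x * cell_density b j y \<partial>?L \<partial>?L)"
      by (subst lborel.nn_integral_fst[symmetric]) auto
    also have "\<dots> = 1" using ij by (simp add: nn_integral_cmult one)
    finally show "ennreal (w i j) * ennreal (c i j) * (\<integral>\<^sup>+z. cell_density b i (fst z) * cell_density b j (snd z) \<partial>(?L \<Otimes>\<^sub>M ?L))
      = ennreal (w i j) * ennreal (c i j)" by simp
  qed
  also have "\<dots> = (\<Sum>i\<in>?I. \<Sum>j\<in>?I. ennreal (w i j * c i j))"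
    using w c by (intro sum.cong refl) (simp add: ennreal_mult)
  also have "\<dots> = ennreal ?S"
    using w c by (subst sum_ennreal[symmetric]; (intro sum_nonneg mult_nonneg_nonneg sum.cong refl)?)+ simp_all
  finally have "(\<integral>\<^sup>+z. ennreal (lp_dist p (fst z) (snd z) powr v) \<partial>J) \<le> ennreal ?S" .
  then have "(INF \<pi>\<in>couplings (psi b P) (psi b Q). \<integral>\<^sup>+ z. ennreal (lp_dist p (fst z) (snd z) powr v) \<partial>\<pi>) \<le> ennreal ?S"
    using INF_lower[OF J] by (rule order_trans[rotated])
  then have "enn2real (INF \<pi>\<in>couplings (psi b P) (psi b Q). \<integral>\<^sup>+ z. ennreal (lp_dist p (fst z) (snd z) powr v) \<partial>\<pi>) \<le> ?S"
    using w c by (intro enn2real_leI) (auto intro!: sum_nonneg mult_nonneg_nonneg)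
  then show ?thesis
    unfolding wasserstein_def using v by (intro powr_mono2) auto
qed

section \<open>Dyadic cells\<close>

text \<open>Indices start at 1; after the shift, the division drops the last \<open>m\<close> binary
  digits of each coordinate. Levels thus count up from the finest partition: for
  \<open>b = 2 ^ K\<close>, level \<open>m\<close> consists of cells of side
  \<open>2 ^ m / 2 ^ K\<close>.\<close>

definition coarse :: "nat \<Rightarrow> ('d \<Rightarrow> nat) \<Rightarrow> 'd \<Rightarrow> nat" where
  "coarse m i = (\<lambda>l. (i l - 1) div 2 ^ m)"

lemma coarse_Suc: "coarse (Suc m) i l = coarse m i l div 2"
  by (simp add: coarse_def div_mult2_eq[symmetric] mult.commute)

lemma coarse_top:
  fixes i :: "'d::finite \<Rightarrow> nat"
  assumes "i \<in> idx (2 ^ K)"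
  shows "coarse K i = (\<lambda>_. 0)"
proof
  fix l
  have "1 \<le> i l" "i l \<le> 2 ^ K" using assms by (auto simp: idx_def PiE_iff)
  then have "i l - 1 < 2 ^ K" by linarith
  then show "coarse K i l = 0" by (simp add: coarse_def)
qed

lemma card_coarse_image:
  assumes "m \<le> K"
  shows "card (coarse m ` (idx (2 ^ K) :: ('d::finite \<Rightarrow> nat) set)) \<le> (2 ^ (K - m)) ^ CARD('d)"
proof -
  have "coarse m ` (idx (2 ^ K) :: ('d \<Rightarrow> nat) set) \<subseteq> PiE UNIV (\<lambda>_. {..<2 ^ (K - m)})"
  proof
    fix a assume "a \<in> coarse m ` (idx (2 ^ K) :: ('d \<Rightarrow> nat) set)"
    then obtain i where i: "i \<in> idx (2 ^ K)" and a: "a = coarse m i" by blast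
    have "a l < 2 ^ (K - m)" for l
    proof -
      have "1 \<le> i l" "i l \<le> 2 ^ K" using i by (auto simp: idx_def PiE_iff)
      then have "i l - 1 < 2 ^ m * 2 ^ (K - m)"
        using assms by (simp add: power_add[symmetric])
      then show ?thesis by (simp add: a coarse_def less_mult_imp_div_less mult.commute)
    qed
    then show "a \<in> PiE UNIV (\<lambda>_. {..<2 ^ (K - m)})" by auto
  qed
  then have "card (coarse m ` (idx (2 ^ K) :: ('d \<Rightarrow> nat) set))
      \<le> card (PiE (UNIV :: 'd set) (\<lambda>_. {..<2 ^ (K - m) :: nat}))"
    by (intro card_mono finite_PiE) auto
  then show ?thesis by (simp add: card_PiE)
qed

section \<open>Diameters of dyadic cells and the transport bound\<close>

lemma lp_dist_le:
  fixes x y :: "real^'d::finite"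
  assumes "1 \<le> p" "\<And>l. \<bar>x $ l - y $ l\<bar> \<le> r"
  shows "lp_dist p x y \<le> real CARD('d) powr (1 / p) * r"
proof -
  have r: "0 \<le> r" using assms(2) by (meson abs_ge_zero order_trans)
  have "(\<Sum>l\<in>UNIV. \<bar>x $ l - y $ l\<bar> powr p) \<le> (\<Sum>l\<in>(UNIV :: 'd set). r powr p)"
    using assms by (intro sum_mono powr_mono2) auto
  then have "lp_dist p x y \<le> (real CARD('d) * r powr p) powr (1 / p)"
    unfolding lp_dist_def using assms by (intro powr_mono2) (auto intro: sum_nonneg)
  also have "\<dots> = real CARD('d) powr (1 / p) * r"
    using assms r by (simp add: powr_mult powr_powr)
  finally show ?thesis .
qed

text \<open>In each coordinate a common quotient \<open>t\<close> confines both points, scaled by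
  \<open>b\<close>, to the interval from \<open>t * 2 ^ m\<close> to
  \<open>(t + 1) * 2 ^ m\<close>.\<close>

lemma lp_dist_coarse_le:
  fixes i j :: "'d::finite \<Rightarrow> nat"
  assumes i: "i \<in> idx b" and j: "j \<in> idx b" and b: "0 < b" and p: "1 \<le> p"
    and x: "x \<in> cell i b" and y: "y \<in> cell j b" and eq: "coarse m i = coarse m j"
  shows "lp_dist p x y \<le> real CARD('d) powr (1 / p) * (2 ^ m / real b)"
proof (intro lp_dist_le p)
  fix l
  define t where "t = coarse m i l"
  have bounds: "real t * 2 ^ m \<le> real (k l - 1)" "real (k l) \<le> (real t + 1) * 2 ^ m"
    if "k \<in> idx b" "coarse m k l = t" for k :: "'d \<Rightarrow> nat"
  proof -
    have k: "1 \<le> k l" using that by (auto simp: idx_def PiE_iff)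
    have "t * 2 ^ m \<le> k l - 1"
      using that(2) by (simp add: coarse_def) (metis div_times_less_eq_dividend)
    then have "real (t * 2 ^ m) \<le> real (k l - 1)" by (rule of_nat_mono)
    then show "real t * 2 ^ m \<le> real (k l - 1)" by simp
    have "k l - 1 < (t + 1) * 2 ^ m"
      using that(2) dividend_less_div_times[of "2 ^ m" "k l - 1"] by (simp add: coarse_def algebra_simps)
    then have "k l \<le> (t + 1) * 2 ^ m" using k by linarith
    then have "real (k l) \<le> real ((t + 1) * 2 ^ m)" by (rule of_nat_mono)
    then show "real (k l) \<le> (real t + 1) * 2 ^ m" by (simp add: distrib_right)
  qed
  have coord: "real t * 2 ^ m \<le> real b * z $ l \<and> real b * z $ l \<le> (real t + 1) * 2 ^ m"
    if "k \<in> idx b" "coarse m k l = t" "z \<in> cell k b" for k and z :: "real^'d"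
  proof -
    have "real (k l - 1) / real b \<le> z $ l" "z $ l < real (k l) / real b"
      using that(3) by (auto simp: cell_def)
    then have "real (k l - 1) \<le> real b * z $ l" "real b * z $ l \<le> real (k l)"
      using b by (auto simp: pos_divide_le_eq pos_less_divide_eq mult.commute)
    with bounds[OF that(1,2)] show ?thesis by linarith
  qed
  have "\<bar>real b * x $ l - real b * y $ l\<bar> \<le> 2 ^ m"
    using coord[OF i _ x] coord[OF j _ y] eq by (simp add: t_def algebra_simps abs_le_iff)
  then have "real b * \<bar>x $ l - y $ l\<bar> \<le> 2 ^ m"
    by (simp add: right_diff_distrib[symmetric] abs_mult)
  then show "\<bar>x $ l - y $ l\<bar> \<le> 2 ^ m / real b"
    using b by (simp add: field_simps)
qed

text \<open>The \<open>v\<close>-th power of the diameter bound for a cell of level \<open>m\<close>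
  when \<open>b = 2 ^ K\<close>.\<close>

definition cell_cost :: "nat \<Rightarrow> real \<Rightarrow> real \<Rightarrow> nat \<Rightarrow> nat \<Rightarrow> real" where
  "cell_cost d p v K m = (real d powr (1 / p) * (2 ^ m / 2 ^ K)) powr v"

lemma cell_cost_nonneg: "0 \<le> cell_cost d p v K m"
  by (simp add: cell_cost_def)

lemma wasserstein_psi_dyadic:
  fixes P Q :: "('d::finite \<Rightarrow> nat) \<Rightarrow> real" and K :: nat and p v :: real
  defines "I \<equiv> idx (2 ^ K) :: ('d \<Rightarrow> nat) set" and "\<epsilon> \<equiv> cell_cost CARD('d) p v K"
  assumes P: "\<And>i. i \<in> I \<Longrightarrow> 0 \<le> P i" "sum P I = 1" and Q: "\<And>i. i \<in> I \<Longrightarrow> 0 \<le> Q i" "sum Q I = 1"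
    and p: "1 \<le> p" and v: "0 < v"
  shows "wasserstein p v (psi (2 ^ K) P) (psi (2 ^ K) Q) \<le> (\<epsilon> 0 + (\<Sum>l<K. \<epsilon> (Suc l) *
    (\<Sum>a\<in>coarse l ` I. \<bar>cell_mass I (coarse l) P a - cell_mass I (coarse l) Q a\<bar>))) powr (1 / v)"
proof -
  \<comment> \<open>A pair is charged the cost of the smallest dyadic cell containing both, as in a
    tree distance. This dominates the true cost and, by minimality of the level, is at most
    \<open>\<epsilon> m\<close> whenever the pair shares a cell of level \<open>m\<close>, as the
    matching requires.\<close>
  define lev where "lev i j = (LEAST m. coarse m i = coarse m j)" for i j :: "'d \<Rightarrow> nat"
  define c where "c i j = \<epsilon> (lev i j)" for i j
  have top: "coarse K i = coarse K j" if "i \<in> I" "j \<in> I" for i j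
    using coarse_top[of i K] coarse_top[of j K] that unfolding I_def by simp
  have lev: "coarse (lev i j) i = coarse (lev i j) j" if "i \<in> I" "j \<in> I" for i j
    unfolding lev_def using top[OF that] by (rule LeastI)
  have mono: "\<epsilon> m \<le> \<epsilon> m'" if "m \<le> m'" for m m'
    unfolding \<epsilon>_def cell_cost_def using that v
    by (intro powr_mono2 mult_left_mono divide_right_mono power_increasing) auto
  have eps: "0 \<le> \<epsilon> m" for m by (simp add: \<epsilon>_def cell_cost_nonneg)
  have c_le: "c i j \<le> \<epsilon> m" if "coarse m i = coarse m j" for m i j
    unfolding c_def lev_def using that by (intro mono Least_le)
  have coarsen: "coarse (Suc m) i = coarse (Suc m) j" if "coarse m i = coarse m j" for m and i j :: "'d \<Rightarrow> nat"
    using that by (auto simp: coarse_Suc fun_eq_iff)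
  have fin: "finite I" by (simp add: I_def)
  have total: "sum P I = sum Q I" using P Q by simp
  obtain w where w: "\<And>i j. i \<in> I \<Longrightarrow> j \<in> I \<Longrightarrow> 0 \<le> w i j"
    "\<And>i. i \<in> I \<Longrightarrow> (\<Sum>j\<in>I. w i j) = P i" "\<And>j. j \<in> I \<Longrightarrow> (\<Sum>i\<in>I. w i j) = Q j"
    and w_cost: "(\<Sum>i\<in>I. \<Sum>j\<in>I. w i j * c i j) \<le> \<epsilon> 0 * (\<Sum>i\<in>I. P i) + (\<Sum>l<K. \<epsilon> (Suc l) *
      (\<Sum>a\<in>coarse l ` I. \<bar>cell_mass I (coarse l) P a - cell_mass I (coarse l) Q a\<bar>))"
    by (rule hierarchical_coupling[where I = I and p = P and q = Q and g = coarse and K = K and c = c and \<epsilon> = \<epsilon>,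
          OF fin P(1) Q(1) total coarsen top c_le eps])
       (assumption | blast intro: that)+
  have "wasserstein p v (psi (2 ^ K) P) (psi (2 ^ K) Q) \<le> (\<Sum>i\<in>I. \<Sum>j\<in>I. w i j * c i j) powr (1 / v)"
    unfolding I_def
  proof (rule wasserstein_psi_le)
    fix i j :: "'d \<Rightarrow> nat" and x y :: "real^'d"
    assume ij: "i \<in> idx (2 ^ K)" "j \<in> idx (2 ^ K)" and xy: "x \<in> cell i (2 ^ K)" "y \<in> cell j (2 ^ K)"
    have "lp_dist p x y \<le> real CARD('d) powr (1 / p) * (2 ^ lev i j / real (2 ^ K))"
      using ij xy p lev by (intro lp_dist_coarse_le[of i _ j]) (auto simp: I_def)
    then show "lp_dist p x y powr v \<le> c i j"
      unfolding c_def \<epsilon>_def cell_cost_def using v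
      by (intro powr_mono2) (auto simp: lp_dist_def)
  qed (use w v eps in \<open>simp_all add: I_def c_def\<close>)
  also have "\<dots> \<le> (\<epsilon> 0 + (\<Sum>l<K. \<epsilon> (Suc l) *
    (\<Sum>a\<in>coarse l ` I. \<bar>cell_mass I (coarse l) P a - cell_mass I (coarse l) Q a\<bar>))) powr (1 / v)"
    using w_cost P(2) w v eps
    by (intro powr_mono2) (auto intro!: sum_nonneg mult_nonneg_nonneg simp: c_def)
  finally show ?thesis .
qed

section \<open>Moments of independent gamma variables\<close>

text \<open>Multiplying the density by \<open>x ^ k\<close> raises the shape parameter by
  \<open>k\<close>, so Euler's integral applies again. Nonnegativity of the integrand carries its
  value over to the Lebesgue integral.\<close>

lemma gamma_dist_moment:
  assumes a: "0 < a"
  shows "has_bochner_integral (gamma_dist a) (\<lambda>x. x ^ k) (Gamma (a + real k) / Gamma a)"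
proof -
  let ?h = "\<lambda>x. if 0 < x then x powr (a - 1) * exp (- x) / Gamma a else 0 :: real"
  have nonneg: "0 \<le> ?h x * x ^ k" for x
    using a by (auto intro!: divide_nonneg_nonneg mult_nonneg_nonneg less_imp_le[OF Gamma_real_pos])
  have meas: "?h \<in> borel_measurable borel" by measurable
  have "((\<lambda>t. t powr (a + real k - 1) / exp t / Gamma a) has_integral Gamma (a + real k) / Gamma a) {0..}"
    using a by (intro has_integral_divide Gamma_integral_real) simp
  then have "((\<lambda>t. ?h t * t ^ k) has_integral Gamma (a + real k) / Gamma a) {0..}"
  proof (rule has_integral_eq[rotated])
    fix x :: real assume "x \<in> {0..}"
    then show "x powr (a + real k - 1) / exp x / Gamma a = ?h x * x ^ k"
    proof (cases "x = 0")
      case False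
      with \<open>x \<in> {0..}\<close> have "x > 0" by simp
      then have "x powr (a + real k - 1) = x powr (a - 1) * x ^ k"
        by (simp add: powr_realpow[symmetric] powr_add[symmetric] algebra_simps)
      then show ?thesis using \<open>x > 0\<close> by (simp add: exp_minus field_simps)
    qed simp
  qed
  then have "((\<lambda>t. ?h t * t ^ k) has_integral Gamma (a + real k) / Gamma a) UNIV"
    by (rule has_integral_on_superset) auto
  then have "(\<integral>\<^sup>+x. ennreal (?h x * x ^ k) \<partial>lborel) = ennreal (Gamma (a + real k) / Gamma a)"
    using nonneg meas by (intro nn_integral_has_integral_lborel) auto
  then have "has_bochner_integral lborel (\<lambda>x. ?h x * x ^ k) (Gamma (a + real k) / Gamma a)"
    using nonneg meas a
    by (intro has_bochner_integral_nn_integral)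
       (auto intro!: divide_nonneg_nonneg less_imp_le[OF Gamma_real_pos])
  then show ?thesis
    unfolding gamma_dist_def using meas a
    by (intro has_bochner_integral_density[where f="\<lambda>x. x ^ k"])
       (auto intro!: divide_nonneg_nonneg mult_nonneg_nonneg less_imp_le[OF Gamma_real_pos] AE_I2)
qed

lemma sets_gamma_dist [measurable_cong, simp]: "sets (gamma_dist a) = sets borel"
  by (simp add: gamma_dist_def)

lemma space_gamma_dist [simp]: "space (gamma_dist a) = UNIV"
  by (simp add: gamma_dist_def)

lemma prob_space_gamma_dist:
  assumes "0 < a"
  shows "prob_space (gamma_dist a)"
proof
  have "has_bochner_integral (gamma_dist a) (\<lambda>x. 1::real) 1"
    using gamma_dist_moment[OF assms, of 0] Gamma_real_pos[OF assms] by simp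
  then have "integrable (gamma_dist a) (\<lambda>x. 1::real)" "(\<integral>x. 1 \<partial>gamma_dist a) = (1::real)"
    by (auto simp: has_bochner_integral_iff)
  then have "(\<integral>\<^sup>+x. ennreal 1 \<partial>gamma_dist a) = ennreal 1"
    using nn_integral_eq_integral[of "gamma_dist a" "\<lambda>x. 1"] by simp
  then show "emeasure (gamma_dist a) (space (gamma_dist a)) = 1"
    by simp
qed

lemma AE_gamma_dist_pos: "AE x in gamma_dist a. 0 < x"
  unfolding gamma_dist_def by (subst AE_density) auto

text \<open>Mean and variance both equal the shape parameter. The exponents 0, 1, 2 are treated
  together because a product of two centred coordinates has one of them in every coordinate.\<close>

lemma gamma_dist_central_moments:
  assumes a: "0 < a" and "k \<le> 2"
  shows "has_bochner_integral (gamma_dist a) (\<lambda>x. (x - a) ^ k) (if k = 0 then 1 else if k = 1 then 0 else a)"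
proof -
  have G: "Gamma a > 0" "Gamma (a + 1) = a * Gamma a" "Gamma (a + 2) = (a + 1) * (a * Gamma a)"
    using a Gamma_real_pos[of a] Gamma_plus1[of a] Gamma_plus1[of "a + 1"]
    by (auto simp: add.assoc nonpos_Ints_def)
  have 0: "has_bochner_integral (gamma_dist a) (\<lambda>x. 1 :: real) 1"
    using gamma_dist_moment[OF a, of 0] G by simp
  have 1: "has_bochner_integral (gamma_dist a) (\<lambda>x. x) a"
    using gamma_dist_moment[OF a, of 1] G by simp
  have 2: "has_bochner_integral (gamma_dist a) (\<lambda>x. x ^ 2) (a * (a + 1))"
  proof -
    have "Gamma (a + 2) / Gamma a = a * (a + 1)"
      using G by (simp add: field_simps)
    then show ?thesis using gamma_dist_moment[OF a, of 2] by simp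
  qed
  have "has_bochner_integral (gamma_dist a) (\<lambda>x. x - a) 0"
    using has_bochner_integral_diff[OF 1 has_bochner_integral_mult_right[OF 0, of a]] by simp
  moreover have "has_bochner_integral (gamma_dist a) (\<lambda>x. (x - a) ^ 2) a"
  proof -
    have "has_bochner_integral (gamma_dist a) (\<lambda>x. x ^ 2 - (2 * a) * x + a ^ 2 * 1) (a * (a + 1) - (2 * a) * a + a ^ 2 * 1)"
      by (intro has_bochner_integral_add has_bochner_integral_diff has_bochner_integral_mult_right 0 1 2) 
    moreover have "(\<lambda>x. x ^ 2 - (2 * a) * x + a ^ 2 * 1) = (\<lambda>x. (x - a) ^ 2)"
      by (auto simp: power2_eq_square algebra_simps)
    moreover have "a * (a + 1) - (2 * a) * a + a ^ 2 * 1 = a"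
      by (simp add: power2_eq_square algebra_simps)
    ultimately show ?thesis by simp
  qed
  moreover have "k = 0 \<or> k = 1 \<or> k = 2" using \<open>k \<le> 2\<close> by auto
  ultimately show ?thesis using 0 by auto
qed

lemma product_gamma_dist_covariance:
  fixes a :: "'i \<Rightarrow> real"
  assumes I: "finite I" and a: "\<And>i. i \<in> I \<Longrightarrow> 0 < a i" and ij: "i \<in> I" "j \<in> I"
  shows "has_bochner_integral (PiM I (\<lambda>i. gamma_dist (a i)))
    (\<lambda>G. (G i - a i) * (G j - a j)) (if i = j then a i else 0)"
proof -
  \<comment> \<open>The locale asks for a sigma-finite measure at every index, so \<open>a\<close>
    is extended by a positive value outside \<open>I\<close>.\<close>
  define a' where "a' i = (if i \<in> I then a i else 1)" for i
  have a': "a' k > 0" for k using a by (auto simp: a'_def)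
  interpret product_sigma_finite "\<lambda>i. gamma_dist (a' i)"
    by (simp add: product_sigma_finite_def prob_space_imp_sigma_finite prob_space_gamma_dist a')
  \<comment> \<open>With these exponents the product over \<open>I\<close> is the product of the
    \<open>i\<close>-th and the \<open>j\<close>-th factor, a square when \<open>i = j\<close>. For
    \<open>i \<noteq> j\<close> the integral factorises and contains a vanishing first
    moment.\<close>
  define e where "e k = (if k = i then 1 else 0) + (if k = j then 1 else 0 :: nat)" for k
  have e: "e k \<le> 2" for k by (simp add: e_def)
  have P: "PiM I (\<lambda>i. gamma_dist (a i)) = PiM I (\<lambda>i. gamma_dist (a' i))"
    by (intro PiM_cong) (auto simp: a'_def)
  have prod_e: "(\<Prod>k\<in>I. z k ^ e k) = z i * z j" for z :: "'i \<Rightarrow> real"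
    using I ij by (simp add: e_def power_add prod.distrib if_distrib[of "power _"] prod.delta cong: if_cong)
  note m = gamma_dist_central_moments[OF a' e, unfolded has_bochner_integral_iff]
  have "integrable (PiM I (\<lambda>i. gamma_dist (a' i))) (\<lambda>G. \<Prod>k\<in>I. (G k - a' k) ^ e k)"
    using m by (intro product_integrable_prod I) auto
  moreover have "(\<integral>G. (\<Prod>k\<in>I. (G k - a' k) ^ e k) \<partial>PiM I (\<lambda>i. gamma_dist (a' i)))
      = (\<Prod>k\<in>I. \<integral>x. (x - a' k) ^ e k \<partial>gamma_dist (a' k))"
    using m by (intro product_integral_prod I) auto
  moreover have "(\<Prod>k\<in>I. \<integral>x. (x - a' k) ^ e k \<partial>gamma_dist (a' k)) = (if i = j then a i else 0)"
  proof (cases "i = j")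
    case True
    have "(\<Prod>k\<in>I. \<integral>x. (x - a' k) ^ e k \<partial>gamma_dist (a' k)) = (\<Prod>k\<in>I. if k = i then a' k else 1)"
      using m by (intro prod.cong) (auto simp: e_def True)
    then show ?thesis using True I ij by (simp add: a'_def)
  next
    case False
    have "(\<integral>x. (x - a' i) ^ e i \<partial>gamma_dist (a' i)) = 0"
      using m[of i i] False by (auto simp: e_def)
    then show ?thesis using False I ij by (auto intro: prod_zero)
  qed
  ultimately have "has_bochner_integral (PiM I (\<lambda>i. gamma_dist (a' i)))
      (\<lambda>G. (G i - a' i) * (G j - a' j)) (if i = j then a i else 0)"
    unfolding prod_e by (simp add: has_bochner_integral_iff)
  then show ?thesis
    unfolding P using ij by (simp add: a'_def)
qed

lemma product_gamma_dist_variance: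
  fixes a c :: "'i \<Rightarrow> real"
  assumes I: "finite I" and a: "\<And>i. i \<in> I \<Longrightarrow> 0 < a i"
  shows "has_bochner_integral (PiM I (\<lambda>i. gamma_dist (a i)))
    (\<lambda>G. (\<Sum>i\<in>I. c i * (G i - a i))\<^sup>2) (\<Sum>i\<in>I. (c i)\<^sup>2 * a i)"
proof -
  have "has_bochner_integral (PiM I (\<lambda>i. gamma_dist (a i)))
    (\<lambda>G. \<Sum>i\<in>I. \<Sum>j\<in>I. (c i * c j) * ((G i - a i) * (G j - a j)))
    (\<Sum>i\<in>I. \<Sum>j\<in>I. (c i * c j) * (if i = j then a i else 0))"
    by (intro has_bochner_integral_sum has_bochner_integral_mult_right product_gamma_dist_covariance I a)
  moreover have "(\<Sum>i\<in>I. \<Sum>j\<in>I. (c i * c j) * ((G i - a i) * (G j - a j)))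
      = (\<Sum>i\<in>I. c i * (G i - a i))\<^sup>2" for G
    by (simp add: power2_eq_square sum_product mult_ac)
  moreover have "(\<Sum>i\<in>I. \<Sum>j\<in>I. (c i * c j) * (if i = j then a i else 0)) = (\<Sum>i\<in>I. (c i)\<^sup>2 * a i)"
    using I by (simp add: if_distrib sum.delta power2_eq_square cong: if_cong)
  ultimately show ?thesis by simp
qed

section \<open>Tail bound for the Dirichlet posterior\<close>

text \<open>Subtracting the share of the random total, not of its mean, still gives a linear form,
  with coefficients indicator minus \<open>\<mu>\<close>. The choice of \<open>\<mu>\<close> makes
  it centred, so the variance formula yields its second moment.\<close>

lemma product_gamma_dist_cell_deviation:
  fixes a :: "'i \<Rightarrow> real" and f :: "'i \<Rightarrow> 'c"
  assumes I: "finite I" and a: "\<And>i. i \<in> I \<Longrightarrow> 0 < a i"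
    and S: "sum a I = S" "0 < S" and \<mu>: "cell_mass I f a x = \<mu> * S"
  shows "has_bochner_integral (PiM I (\<lambda>i. gamma_dist (a i)))
    (\<lambda>G. (cell_mass I f G x - \<mu> * sum G I)\<^sup>2) (S * \<mu> * (1 - \<mu>))"
proof -
  define c where "c i = (if f i = x then 1 else 0) - \<mu>" for i
  have cell: "(\<Sum>i\<in>I. (if f i = x then 1 else 0) * g i) = cell_mass I f g x" for g :: "'i \<Rightarrow> real"
    unfolding cell_mass_def sum.inter_filter[OF I] by (intro sum.cong) auto
  have "(\<Sum>i\<in>I. c i * (G i - a i)) = cell_mass I f G x - \<mu> * sum G I" for G
  proof -
    have "(\<Sum>i\<in>I. c i * (G i - a i)) = cell_mass I f (\<lambda>i. G i - a i) x - \<mu> * (sum G I - sum a I)"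
      unfolding c_def left_diff_distrib sum_subtractf[of "\<lambda>i. _ i * _ i"] cell[symmetric]
      by (simp add: sum_distrib_left sum_subtractf right_diff_distrib)
    then show ?thesis using S \<mu> by (simp add: cell_mass_diff algebra_simps)
  qed
  moreover have "(\<Sum>i\<in>I. (c i)\<^sup>2 * a i) = S * \<mu> * (1 - \<mu>)"
  proof -
    have "(\<Sum>i\<in>I. (c i)\<^sup>2 * a i) = (\<Sum>i\<in>I. (1 - 2 * \<mu>) * ((if f i = x then 1 else 0) * a i) + \<mu>\<^sup>2 * a i)"
      by (intro sum.cong refl) (auto simp: c_def power2_eq_square algebra_simps)
    also have "\<dots> = (1 - 2 * \<mu>) * cell_mass I f a x + \<mu>\<^sup>2 * S"
      unfolding sum.distrib sum_distrib_left[symmetric] cell S(1) ..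
    also have "\<dots> = S * \<mu> * (1 - \<mu>)"
      unfolding \<mu> by (simp add: power2_eq_square algebra_simps)
    finally show ?thesis .
  qed
  ultimately show ?thesis
    using product_gamma_dist_variance[where I = I and a = a and c = c, OF I a] by simp
qed

text \<open>Trades an absolute value for a quadratic with a free parameter, so that only second
  moments need to be integrated; optimising \<open>t\<close> afterwards recovers
  Cauchy-Schwarz.\<close>

lemma abs_le_half_square:
  fixes x t :: real
  assumes "0 < t"
  shows "2 * \<bar>x\<bar> \<le> x\<^sup>2 / t + t"
proof -
  have "0 \<le> (\<bar>x\<bar> - t)\<^sup>2 / t" using assms by simp
  also have "(\<bar>x\<bar> - t)\<^sup>2 / t = x\<^sup>2 / t + t - 2 * \<bar>x\<bar>"
    using assms by (simp add: field_simps power2_eq_square)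
  finally show ?thesis by simp
qed

text \<open>With \<open>T\<close> the sum of the independent gamma variables \<open>G i\<close>, normalising by \<open>T\<close> is harmless on
  \<open>T \<ge> S / 2\<close>, an event of probability at least \<open>1 - 4 / S\<close>; there \<open>\<pi>(A) - \<mu>(A)\<close> is at most
  \<open>2 / S\<close> times \<open>\<bar>G(A) - \<mu>(A) T\<bar>\<close>, which is linear in \<open>G\<close>.\<close>

lemma dirichlet_wasserstein_tail:
  fixes a :: "('d::finite \<Rightarrow> nat) \<Rightarrow> real" and K :: nat and p v \<tau> :: real
  defines "I \<equiv> idx (2 ^ K) :: ('d \<Rightarrow> nat) set" and "\<epsilon> \<equiv> cell_cost CARD('d) p v K"
  assumes a: "\<And>i. i \<in> I \<Longrightarrow> 0 < a i" and S: "sum a I = S" "0 < S"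
    and p: "1 \<le> p" and v: "0 < v" and \<tau>: "0 < \<tau>"
  shows "measure (dirichlet I a) {\<pi> \<in> space (dirichlet I a).
      \<tau> \<le> wasserstein p v (psi (2 ^ K) \<pi>) (psi (2 ^ K) (\<lambda>i. a i / S))}
    \<le> 4 / S + (\<epsilon> 0 + (\<Sum>l<K. \<epsilon> (Suc l) * (2 * sqrt ((2 ^ (K - l)) ^ CARD('d) / S)))) / \<tau> powr v"
    (is "measure ?D ?A \<le> ?bound")
proof (cases "?A \<in> sets ?D")
  \<comment> \<open>Outside the sigma-algebra \<open>measure\<close> is 0, so it is enough that the
    bound is nonnegative.\<close>
  case False
  have "0 \<le> ?bound"
    using S(2) by (intro add_nonneg_nonneg divide_nonneg_nonneg sum_nonneg mult_nonneg_nonneg)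
      (simp_all add: \<epsilon>_def cell_cost_nonneg)
  with False show ?thesis by (simp add: measure_notin_sets)
next
  case A: True
  have I: "finite I" by (simp add: I_def)
  define N where "N = PiM I (\<lambda>i. gamma_dist (a i))"
  interpret N: prob_space N
    unfolding N_def by (intro prob_space_PiM prob_space_gamma_dist a)
  define h where "h G = restrict (\<lambda>i. G i / (\<Sum>j\<in>I. G j)) I" for G :: "('d \<Rightarrow> nat) \<Rightarrow> real"
  have sets_N: "sets N = sets (PiM I (\<lambda>_. borel))"
    unfolding N_def by (intro sets_PiM_cong) auto
  have h: "h \<in> measurable N (PiM I (\<lambda>_. borel))"
    unfolding h_def measurable_cong_sets[OF sets_N refl] by measurable
  have D: "?D = distr N (PiM I (\<lambda>_. borel)) h"
    unfolding dirichlet_def N_def h_def ..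
  have pos: "AE G in N. \<forall>i\<in>I. 0 < G i"
    unfolding N_def
    by (intro AE_finite_allI I AE_PiM_component prob_space_gamma_dist AE_gamma_dist_pos a)
  define \<mu> where "\<mu> l x = cell_mass I (coarse l) a x / S" for l x
  define n where "n l = real ((2 ^ (K - l)) ^ CARD('d))" for l
  \<comment> \<open>This value balances the two terms of the quadratic bound: the variances of a
    level sum to at most \<open>S\<close>, and \<open>S / t l = n l * t l\<close>, where
    \<open>n l\<close> bounds the number of cells.\<close>
  define t where "t l = sqrt (S / n l)" for l
  have n: "0 < n l" and t: "0 < t l" for l using S(2) by (simp_all add: n_def t_def)
  define X where "X l x G = cell_mass I (coarse l) G x - \<mu> l x * sum G I" for l x and G :: "('d \<Rightarrow> nat) \<Rightarrow> real"
  define V where "V G = \<epsilon> 0 + (\<Sum>l<K. \<epsilon> (Suc l) * ((\<Sum>x\<in>coarse l ` I. (X l x G)\<^sup>2 / t l) + n l * t l) / S)" for G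
  \<comment> \<open>\<open>F\<close> dominates the indicator of the event: the first term is at
    least 1 where \<open>sum G I < S / 2\<close>, the second where \<open>sum G I\<close> is larger
    and the distance reaches \<open>\<tau>\<close>. Integrating it performs Chebyshev and Markov at
    once.\<close>
  define F where "F G = 4 / S\<^sup>2 * (\<Sum>i\<in>I. 1 * (G i - a i))\<^sup>2 + V G / \<tau> powr v" for G
  define EV where "EV = \<epsilon> 0 + (\<Sum>l<K. \<epsilon> (Suc l) * ((\<Sum>x\<in>coarse l ` I. (S * \<mu> l x * (1 - \<mu> l x)) / t l) + n l * t l) / S)"
  have eps: "0 \<le> \<epsilon> m" for m by (simp add: \<epsilon>_def cell_cost_nonneg)
  have const: "has_bochner_integral N (\<lambda>_. c) c" for c :: real
    by (simp add: has_bochner_integral_iff N.prob_space)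
  have F_int: "has_bochner_integral N F (4 / S\<^sup>2 * (\<Sum>i\<in>I. 1\<^sup>2 * a i) + EV / \<tau> powr v)"
    unfolding F_def V_def EV_def N_def X_def
    by (intro has_bochner_integral_add has_bochner_integral_mult_right has_bochner_integral_divide
        has_bochner_integral_sum const[unfolded N_def] product_gamma_dist_variance I a
        product_gamma_dist_cell_deviation S) (use S in \<open>auto simp: \<mu>_def t_def n_def\<close>)
  have mean_ge: "0 \<le> \<mu> l x" for l x
    unfolding \<mu>_def using S(2) by (intro divide_nonneg_nonneg cell_mass_nonneg) (auto intro: less_imp_le[OF a])
  have "EV \<le> \<epsilon> 0 + (\<Sum>l<K. \<epsilon> (Suc l) * (2 * sqrt (n l / S)))"
    unfolding EV_def
  proof (intro add_left_mono sum_mono)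
    fix l
    have "(\<Sum>x\<in>coarse l ` I. (S * \<mu> l x * (1 - \<mu> l x)) / t l) \<le> (\<Sum>x\<in>coarse l ` I. cell_mass I (coarse l) a x / t l)"
    proof (intro sum_mono divide_right_mono)
      fix x
      have "S * \<mu> l x * (1 - \<mu> l x) \<le> S * \<mu> l x * 1"
        using mean_ge[of l x] S(2) by (intro mult_left_mono) auto
      also have "\<dots> = cell_mass I (coarse l) a x" using S(2) by (simp add: \<mu>_def)
      finally show "S * \<mu> l x * (1 - \<mu> l x) \<le> cell_mass I (coarse l) a x" .
    qed (use t[of l] in auto)
    also have "\<dots> = S / t l"
      by (simp add: sum_divide_distrib[symmetric] sum_cell_mass[OF I] S)
    also have "S / t l = n l * t l"
      using t[of l] n[of l] S(2) by (simp add: t_def field_simps real_sqrt_divide)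
    finally have "((\<Sum>x\<in>coarse l ` I. (S * \<mu> l x * (1 - \<mu> l x)) / t l) + n l * t l) / S \<le> 2 * (n l * t l / S)"
      using S(2) by (simp add: field_simps)
    also have "n l * t l / S = sqrt (n l / S)"
    proof -
      have "n l = sqrt (n l) * sqrt (n l)" "S = sqrt S * sqrt S" using n[of l] S(2) by simp_all
      then show ?thesis
        using n[of l] S(2) unfolding t_def real_sqrt_divide by (simp add: field_simps)
    qed
    finally show "\<epsilon> (Suc l) * ((\<Sum>x\<in>coarse l ` I. (S * \<mu> l x * (1 - \<mu> l x)) / t l) + n l * t l) / S
        \<le> \<epsilon> (Suc l) * (2 * sqrt (n l / S))"
      using mult_left_mono[OF _ eps[of "Suc l"]] by (simp only: times_divide_eq_right[symmetric])
  qed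
  then have EF: "4 / S\<^sup>2 * (\<Sum>i\<in>I. 1\<^sup>2 * a i) + EV / \<tau> powr v \<le> ?bound"
    using S(2) \<tau> by (intro add_mono divide_right_mono) (auto simp: n_def power2_eq_square S(1))
  have dom: "indicator (h -` ?A \<inter> space N) G \<le> F G" if G: "\<forall>i\<in>I. 0 < G i" for G
  proof -
    have V: "\<epsilon> 0 \<le> V G"
      unfolding V_def using S(2)
      by (intro le_add_same_cancel1[THEN iffD2] sum_nonneg divide_nonneg_nonneg mult_nonneg_nonneg
          add_nonneg_nonneg eps zero_le_power2) (simp_all add: less_imp_le[OF t] less_imp_le[OF n])
    then have V0: "0 \<le> V G / \<tau> powr v" using eps[of 0] by simp
    have sq: "0 \<le> 4 / S\<^sup>2 * (\<Sum>i\<in>I. 1 * (G i - a i))\<^sup>2" by simp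
    show ?thesis
    proof (cases "G \<in> h -` ?A")
      case False
      then have "indicator (h -` ?A \<inter> space N) G = (0 :: real)" by auto
      then show ?thesis using add_nonneg_nonneg[OF sq V0] by (simp only: F_def)
    next
      case True
      let ?T = "sum G I"
      have "1 \<le> F G"
      proof (cases "S / 2 \<le> ?T")
        case False
        have "(S / 2)\<^sup>2 \<le> (S - ?T)\<^sup>2" using False S(2) by (intro power_mono) auto
        also have "\<dots> = (\<Sum>i\<in>I. 1 * (G i - a i))\<^sup>2"
          using S(1) by (simp add: sum_subtractf power2_commute)
        finally have "1 \<le> 4 / S\<^sup>2 * (\<Sum>i\<in>I. 1 * (G i - a i))\<^sup>2"
          using S(2) by (simp add: field_simps power2_eq_square)
        then show ?thesis unfolding F_def using V0 by linarith
      next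
        case T: True
        then have T0: "0 < ?T" using S(2) by linarith
        let ?U = "\<epsilon> 0 + (\<Sum>l<K. \<epsilon> (Suc l) *
          (\<Sum>x\<in>coarse l ` I. \<bar>cell_mass I (coarse l) (h G) x - cell_mass I (coarse l) (\<lambda>i. a i / S) x\<bar>))"
        have hG: "sum (h G) I = 1"
          using T0 by (simp add: h_def sum_divide_distrib[symmetric])
        have aS: "(\<Sum>i\<in>I. a i / S) = 1"
          using S by (simp add: sum_divide_distrib[symmetric])
        have "wasserstein p v (psi (2 ^ K) (h G)) (psi (2 ^ K) (\<lambda>i. a i / S)) \<le> ?U powr (1 / v)"
          unfolding I_def \<epsilon>_def
          by (rule wasserstein_psi_dyadic[OF _ _ _ _ p v])
             (use G T0 S(2) a hG aS in \<open>auto simp: h_def I_def less_imp_le divide_nonneg_pos\<close>)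
        then have "\<tau> \<le> ?U powr (1 / v)" using True by auto
        then have "\<tau> powr v \<le> (?U powr (1 / v)) powr v"
          using \<tau> v by (intro powr_mono2) auto
        also have "\<dots> = ?U"
          using v eps by (simp add: powr_powr add_nonneg_nonneg sum_nonneg mult_nonneg_nonneg)
        also have "?U \<le> V G"
          unfolding V_def
        proof (intro add_left_mono sum_mono)
          fix l assume "l \<in> {..<K}"
          have dev: "\<bar>cell_mass I (coarse l) (h G) x - cell_mass I (coarse l) (\<lambda>i. a i / S) x\<bar>
              \<le> ((X l x G)\<^sup>2 / t l + t l) / S" for x
          proof -
            have "cell_mass I (coarse l) (h G) x = cell_mass I (coarse l) G x / ?T"
              by (simp add: cell_mass_def h_def sum_divide_distrib)
            moreover have "cell_mass I (coarse l) (\<lambda>i. a i / S) x = \<mu> l x"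
              by (simp add: cell_mass_def \<mu>_def sum_divide_distrib)
            ultimately have "\<bar>cell_mass I (coarse l) (h G) x - cell_mass I (coarse l) (\<lambda>i. a i / S) x\<bar> = \<bar>X l x G\<bar> / ?T"
              using T0 by (simp add: X_def diff_divide_distrib abs_divide[symmetric] del: abs_divide)
                (simp add: field_simps)
            also have "\<dots> \<le> \<bar>X l x G\<bar> / (S / 2)"
              using T S(2) by (intro divide_left_mono) auto
            also have "\<dots> = 2 * \<bar>X l x G\<bar> / S" by simp
            also have "\<dots> \<le> ((X l x G)\<^sup>2 / t l + t l) / S"
              using S(2) by (intro divide_right_mono abs_le_half_square t) auto
            finally show ?thesis .
          qed
          have "(\<Sum>x\<in>coarse l ` I. \<bar>cell_mass I (coarse l) (h G) x - cell_mass I (coarse l) (\<lambda>i. a i / S) x\<bar>)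
              \<le> (\<Sum>x\<in>coarse l ` I. ((X l x G)\<^sup>2 / t l + t l) / S)"
            by (intro sum_mono dev)
          also have "\<dots> = ((\<Sum>x\<in>coarse l ` I. (X l x G)\<^sup>2 / t l) + real (card (coarse l ` I)) * t l) / S"
            by (simp add: sum_divide_distrib[symmetric] sum.distrib)
          also have "\<dots> \<le> ((\<Sum>x\<in>coarse l ` I. (X l x G)\<^sup>2 / t l) + n l * t l) / S"
            using card_coarse_image[of l K, where 'd = 'd] \<open>l \<in> {..<K}\<close> t[of l] S(2)
            unfolding n_def I_def
            by (intro divide_right_mono add_left_mono mult_right_mono of_nat_mono) auto
          finally show "\<epsilon> (Suc l) * (\<Sum>x\<in>coarse l ` I. \<bar>cell_mass I (coarse l) (h G) x - cell_mass I (coarse l) (\<lambda>i. a i / S) x\<bar>)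
              \<le> \<epsilon> (Suc l) * ((\<Sum>x\<in>coarse l ` I. (X l x G)\<^sup>2 / t l) + n l * t l) / S"
            using mult_left_mono[OF _ eps[of "Suc l"]] by (simp only: times_divide_eq_right[symmetric])
        qed
        finally have "1 \<le> V G / \<tau> powr v" using \<tau> by simp
        then show ?thesis unfolding F_def using sq by linarith
      qed
      then show ?thesis by (simp add: indicator_def)
    qed
  qed
  have "sets ?D = sets (PiM I (\<lambda>_. borel))" unfolding D by (rule sets_distr)
  with A have A': "?A \<in> sets (PiM I (\<lambda>_. borel))" by blast
  have hA: "h -` ?A \<inter> space N \<in> sets N" by (rule measurable_sets[OF h A'])
  have "measure ?D B = measure N (h -` B \<inter> space N)" if "B \<in> sets (PiM I (\<lambda>_. borel))" for B
    unfolding D by (rule measure_distr[OF h that])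
  then have "measure ?D ?A = measure N (h -` ?A \<inter> space N)"
    using A' by blast
  also have "\<dots> = (\<integral>G. indicator (h -` ?A \<inter> space N) G \<partial>N)"
    using hA by simp
  also have "\<dots> \<le> (\<integral>G. F G \<partial>N)"
  proof (rule integral_mono_AE)
    show "AE G in N. indicator (h -` ?A \<inter> space N) G \<le> F G"
      using pos by eventually_elim (rule dom)
    show "integrable N (indicator (h -` ?A \<inter> space N) :: _ \<Rightarrow> real)"
      by (intro integrable_real_indicator hA) (simp add: N.emeasure_eq_measure)
  qed (use F_int in \<open>simp add: has_bochner_integral_iff\<close>)
  also have "\<dots> \<le> ?bound"
    using F_int EF by (simp add: has_bochner_integral_iff)
  finally show ?thesis .
qed

section \<open>Rates\<close>

text \<open>The dyadic bound for total concentration \<open>n\<close>, with the dimension constant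
  divided out. Here \<open>k\<close> counts levels from the coarsest: mass moves within cells of
  side \<open>2 ^ -k\<close> but is compared on cells half as wide, which produces the factor
  \<open>2 powr (d / 2)\<close>.\<close>

definition transport_rate :: "nat \<Rightarrow> real \<Rightarrow> nat \<Rightarrow> nat \<Rightarrow> real" where
  "transport_rate d v K n = 2 powr (- (real K * v))
     + 2 * 2 powr (real d / 2) / sqrt (real n) * (\<Sum>k<K. (2 powr (real d / 2 - v)) ^ k)"

lemma cell_costs_eq_transport_rate:
  "cell_cost d p v K 0 + (\<Sum>l<K. cell_cost d p v K (Suc l) * (2 * sqrt ((2 ^ (K - l)) ^ d / real n)))
    = (real d powr (1 / p)) powr v * transport_rate d v K n"
proof -
  define D where "D = (real d powr (1 / p)) powr v"
  have cost: "cell_cost d p v K m = D * 2 powr (- (real (K - m) * v))" if "m \<le> K" for m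
  proof -
    have "(2 :: real) ^ m / 2 ^ K = 2 powr (- real (K - m))"
      using that by (simp add: powr_realpow[symmetric] powr_diff[symmetric] of_nat_diff)
    then show ?thesis by (simp add: cell_cost_def D_def powr_mult powr_powr)
  qed
  have root: "sqrt ((2 ^ m) ^ d / real n) = 2 powr (real m * real d / 2) / sqrt (real n)" for m
    by (simp add: real_sqrt_divide powr_half_sqrt[symmetric] powr_realpow[symmetric] powr_powr power_mult[symmetric])
  have "(\<Sum>l<K. cell_cost d p v K (Suc l) * (2 * sqrt ((2 ^ (K - l)) ^ d / real n)))
      = (\<Sum>k<K. D * 2 powr (- (real k * v)) * (2 * (2 powr (real (Suc k) * real d / 2) / sqrt (real n))))"
  proof (subst sum.nat_diff_reindex[symmetric], intro sum.cong refl)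
    fix l assume "l \<in> {..<K}"
    then have "K - Suc (K - Suc l) = l" "K - (K - Suc l) = Suc l" "Suc (K - Suc l) \<le> K" by auto
    then show "cell_cost d p v K (Suc (K - Suc l)) * (2 * sqrt ((2 ^ (K - (K - Suc l))) ^ d / real n))
        = D * 2 powr (- (real l * v)) * (2 * (2 powr (real (Suc l) * real d / 2) / sqrt (real n)))"
      by (simp only: cost root)
  qed
  also have "\<dots> = (\<Sum>k<K. D * (2 * 2 powr (real d / 2) / sqrt (real n) * (2 powr (real d / 2 - v)) ^ k))"
  proof (intro sum.cong refl)
    fix k
    have "2 powr (- (real k * v)) * 2 powr (real (Suc k) * real d / 2)
        = 2 powr (real d / 2) * (2 powr (real d / 2 - v)) ^ k"
      by (simp add: powr_realpow[symmetric] powr_powr powr_add[symmetric] field_simps)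
    then show "D * 2 powr (- (real k * v)) * (2 * (2 powr (real (Suc k) * real d / 2) / sqrt (real n)))
        = D * (2 * 2 powr (real d / 2) / sqrt (real n) * (2 powr (real d / 2 - v)) ^ k)"
      by (simp add: mult.assoc mult.left_commute)
  qed
  finally show ?thesis
    unfolding transport_rate_def D_def[symmetric]
    by (simp add: cost distrib_left sum_distrib_left)
qed

section \<open>Total concentration and the posterior bound for fixed data\<close>

lemma unit_cube_subset_cells:
  assumes "0 < b" "y \<in> unit_cube"
  shows "\<exists>i\<in>idx b. y \<in> cell i b"
proof
  \<comment> \<open>\<open>Suc\<close> turns the zero-based integer part into an index starting at
    1.\<close>
  define i where "i l = Suc (nat \<lfloor>real b * y $ l\<rfloor>)" for l
  have y: "0 \<le> y $ l" "y $ l < 1" for l using assms(2) by (auto simp: unit_cube_def)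
  have i: "real (i l - 1) \<le> real b * y $ l" "real b * y $ l < real (i l)" for l
    using y[of l] assms(1) unfolding i_def by (simp_all add: of_nat_nat) linarith+
  have "real b * y $ l < real b" for l using y[of l] assms(1) by simp
  with i(1) have "real (i l - 1) < real b" for l by (rule order_le_less_trans)
  then have "1 \<le> i l \<and> i l \<le> b" for l by (metis i_def diff_Suc_1 of_nat_less_iff Suc_leI le_add1 plus_1_eq_Suc)
  then show "i \<in> idx b" by (auto simp: idx_def)
  show "y \<in> cell i b"
    unfolding cell_def using i assms(1) by (auto simp: field_simps)
qed

text \<open>Every observation falls into some cell, so the counts sum to at least \<open>n\<close>.
  A lower bound is enough, since the tail bound decreases in the total concentration.\<close>

lemma sum_post_conc_ge:
  assumes "0 < b" "\<And>t. y t \<in> unit_cube" "\<And>i. i \<in> idx b \<Longrightarrow> 0 \<le> \<alpha> i"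
  shows "real n \<le> (\<Sum>i\<in>idx b. post_conc \<alpha> b y n i)"
proof -
  have "{1..n} \<subseteq> (\<Union>i\<in>idx b. {t\<in>{1..n}. y t \<in> cell i b})"
    using unit_cube_subset_cells[OF assms(1,2)] by auto
  then have "card {1..n} \<le> card (\<Union>i\<in>idx b. {t\<in>{1..n}. y t \<in> cell i b})"
    by (intro card_mono) auto
  also have "\<dots> \<le> (\<Sum>i\<in>idx b. card {t\<in>{1..n}. y t \<in> cell i b})"
    by (intro card_UN_le) simp
  finally have "real n \<le> (\<Sum>i\<in>idx b. real (card {t\<in>{1..n}. y t \<in> cell i b}))"
    by (simp flip: of_nat_sum)
  also have "\<dots> \<le> (\<Sum>i\<in>idx b. post_conc \<alpha> b y n i)"
    using assms(3) by (intro sum_mono) (simp add: post_conc_def)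
  finally show ?thesis .
qed

lemma post_prob_le:
  fixes y :: "nat \<Rightarrow> real^'d::finite"
  assumes y: "\<And>t. y t \<in> unit_cube" and \<alpha>: "\<And>i. i \<in> idx (2 ^ K) \<Longrightarrow> 0 < \<alpha> i"
    and n: "0 < n" and p: "1 \<le> p" and v: "0 < v" and \<tau>: "0 < \<tau>"
  shows "post_prob p v \<alpha> (2 ^ K) y n \<tau>
    \<le> 4 / real n + (real CARD('d) powr (1 / p)) powr v * transport_rate CARD('d) v K n / \<tau> powr v"
proof -
  let ?a = "post_conc \<alpha> (2 ^ K) y n" and ?d = "CARD('d)"
  define S where "S = sum ?a (idx (2 ^ K))"
  have S: "real n \<le> S"
    unfolding S_def using y \<alpha> by (intro sum_post_conc_ge) (auto intro: less_imp_le)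
  have a: "0 < ?a i" if "i \<in> idx (2 ^ K)" for i
    using \<alpha>[OF that] by (simp add: post_conc_def add_pos_nonneg)
  have S0: "0 < S" using S n by linarith
  have "post_prob p v \<alpha> (2 ^ K) y n \<tau> \<le> 4 / S + (cell_cost ?d p v K 0
      + (\<Sum>l<K. cell_cost ?d p v K (Suc l) * (2 * sqrt ((2 ^ (K - l)) ^ ?d / S)))) / \<tau> powr v"
    unfolding post_prob_def post_mean_def Let_def S_def[symmetric]
    by (rule dirichlet_wasserstein_tail[OF a S_def[symmetric] S0 p v \<tau>])
  also have "\<dots> \<le> 4 / real n + (cell_cost ?d p v K 0
      + (\<Sum>l<K. cell_cost ?d p v K (Suc l) * (2 * sqrt ((2 ^ (K - l)) ^ ?d / real n)))) / \<tau> powr v"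
    using S S0 n
    by (intro add_mono divide_right_mono divide_left_mono sum_mono mult_left_mono real_sqrt_le_mono
        order_refl cell_cost_nonneg) auto
  finally show ?thesis
    by (simp add: cell_costs_eq_transport_rate)
qed

text \<open>The exponent of the logarithm in \<open>tau\<close> exceeds by \<open>\<gamma> / v\<close> what the order of the transport
  cost requires, so only the positivity of the constants matters.\<close>

lemma transport_rate_le_tau:
  assumes d: "0 < d" and v: "0 < v"
    and C4: "real d < 2 * v \<Longrightarrow> 0 < C 4" and C5: "real d = 2 * v \<Longrightarrow> 0 < C 5" and C6: "2 * v < real d \<Longrightarrow> 0 < C 6"
  shows "\<exists>c. \<forall>n\<ge>3. transport_rate d v (nat \<lceil>log 2 (k_seq d v n)\<rceil>) n
    \<le> c * ln (real n) powr (- \<gamma>) * tau d v \<gamma> C n powr v"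
proof -
  \<comment> \<open>The sign of \<open>\<beta>\<close> separates the three regimes:
    \<open>\<rho>\<close>, the ratio of contributions of consecutive levels, is below, equal to or
    above 1.\<close>
  define \<beta> where "\<beta> = real d / 2 - v"
  define \<rho> where "\<rho> = (2 :: real) powr \<beta>"
  define B where "B = 2 * (2 :: real) powr (real d / 2)"
  define K where "K n = nat \<lceil>log 2 (k_seq d v n)\<rceil>" for n
  have B: "0 \<le> B" by (simp add: B_def)
  have rate: "transport_rate d v (K n) n = 2 powr (- (real (K n) * v)) + B * real n powr (- 1 / 2) * (\<Sum>k<K n. \<rho> ^ k)" if "n \<ge> 3" for n
    using that by (simp add: transport_rate_def B_def \<rho>_def \<beta>_def powr_half_sqrt[symmetric] powr_minus_divide)
  have k1: "1 \<le> k_seq d v n" if "n \<ge> 3" for n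
    using that v by (auto simp: k_seq_def ge_one_powr_ge_zero)
  \<comment> \<open>The logarithm is nonnegative, so \<open>nat\<close> loses nothing and rounding
    up adds at most one level.\<close>
  have K_le: "real (K n) \<le> log 2 (k_seq d v n) + 1" and K_ge: "log 2 (k_seq d v n) \<le> real (K n)"
    if "n \<ge> 3" for n
  proof -
    have "0 \<le> log 2 (k_seq d v n)" using k1[OF that] by simp
    then show "real (K n) \<le> log 2 (k_seq d v n) + 1" "log 2 (k_seq d v n) \<le> real (K n)"
      unfolding K_def by linarith+
  qed
  have lead: "2 powr (- (real (K n) * v)) \<le> k_seq d v n powr (- v)" if "n \<ge> 3" for n
  proof -
    have "2 powr (- (real (K n) * v)) \<le> 2 powr (- (log 2 (k_seq d v n) * v))"
      using K_ge[OF that] v by (intro powr_mono) auto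
    also have "\<dots> = (2 powr log 2 (k_seq d v n)) powr (- v)" by (simp add: powr_powr)
    also have "\<dots> = k_seq d v n powr (- v)" using k1[OF that] by simp
    finally show ?thesis .
  qed
  \<comment> \<open>The threshold 3 exceeds \<open>exp 1\<close>.\<close>
  have ln1: "1 \<le> ln (real n)" if "n \<ge> 3" for n
  proof -
    have "exp 1 \<le> real n" using that exp_le by linarith
    then show ?thesis using that by (simp add: ln_ge_iff)
  qed
  have tau_powr: "(c * real n powr a * ln (real n) powr (g / v)) powr v = c powr v * real n powr (a * v) * ln (real n) powr g"
    if "0 < c" "n \<ge> 3" for c a g n
    using that v ln1[of n] by (simp add: powr_mult powr_powr)
  \<comment> \<open>Here \<open>r\<close> is the power of \<open>n\<close> and \<open>s\<close> the
    logarithmic factor of the cost itself, which is \<open>ln n\<close> in the critical case and 1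
    otherwise.\<close>
  have conclude: "transport_rate d v (K n) n \<le> A / c powr v * ln (real n) powr (- \<gamma>) * tau d v \<gamma> C n powr v"
    if "n \<ge> 3" "0 < c" "tau d v \<gamma> C n powr v = c powr v * r * (s * ln (real n) powr \<gamma>)"
      "transport_rate d v (K n) n \<le> A * (r * s)" for n A c r s
  proof -
    have "A / c powr v * ln (real n) powr (- \<gamma>) * tau d v \<gamma> C n powr v
        = A * (r * s) * (ln (real n) powr (- \<gamma>) * ln (real n) powr \<gamma>)"
      using that(2,3) by simp
    also have "ln (real n) powr (- \<gamma>) * ln (real n) powr \<gamma> = 1"
      using ln1[OF that(1)] by (simp flip: powr_add)
    finally show ?thesis using that(4) by simp
  qed
  consider "real d < 2 * v" | "real d = 2 * v" | "2 * v < real d" by linarith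
  then have "\<exists>c. \<forall>n\<ge>3. transport_rate d v (K n) n \<le> c * ln (real n) powr (- \<gamma>) * tau d v \<gamma> C n powr v"
  proof cases
    case 1
    have \<rho>: "0 < \<rho>" "\<rho> < 1" using 1 powr_less_mono[of \<beta> 0 2] by (auto simp: \<rho>_def \<beta>_def)
    \<comment> \<open>The coarsest levels dominate, so the sum is bounded by the full geometric
      series, uniformly in the number of levels.\<close>
    have sum_le: "(\<Sum>k<m. \<rho> ^ k) \<le> 1 / (1 - \<rho>)" for m
    proof -
      have "(\<Sum>k<m. \<rho> ^ k) = (1 - \<rho> ^ m) / (1 - \<rho>)" using \<rho> by (simp add: sum_gp_strict)
      also have "\<dots> \<le> 1 / (1 - \<rho>)" using \<rho> by (intro divide_right_mono) auto
      finally show ?thesis .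
    qed
    show ?thesis
    proof (intro exI[of _ "(1 + B / (1 - \<rho>)) / C 4 powr v"] allI impI)
      fix n :: nat assume n: "n \<ge> 3"
      have tau: "tau d v \<gamma> C n powr v = C 4 powr v * real n powr (- 1 / 2) * (1 * ln (real n) powr \<gamma>)"
        using 1 v n tau_powr[OF C4[OF 1] n, of "- 1 / (2 * v)" \<gamma>] by (simp add: tau_def)
      have "k_seq d v n powr (- v) = real n powr (- 1 / 2)"
        using 1 v by (simp add: k_seq_def powr_powr)
      then have "transport_rate d v (K n) n \<le> real n powr (- 1 / 2) + B * real n powr (- 1 / 2) * (1 / (1 - \<rho>))"
        unfolding rate[OF n] using lead[OF n] B by (intro add_mono mult_left_mono sum_le) auto
      then have le: "transport_rate d v (K n) n \<le> (1 + B / (1 - \<rho>)) * (real n powr (- 1 / 2) * 1)"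
        by (simp add: algebra_simps)
      show "transport_rate d v (K n) n \<le> (1 + B / (1 - \<rho>)) / C 4 powr v * ln (real n) powr (- \<gamma>) * tau d v \<gamma> C n powr v"
        by (rule conclude[OF n C4[OF 1] tau le])
    qed
  next
    case 2
    \<comment> \<open>All levels contribute equally, so the sum is their number \<open>K n\<close>,
      at most \<open>ln n / (2 * v * ln 2) + 1\<close>; the added 1 is absorbed by
      \<open>ln n \<ge> 1\<close>.\<close>
    define A where "A = 1 + B * (1 / (2 * v * ln 2) + 1)"
    show ?thesis
    proof (intro exI[of _ "(A) / C 5 powr v"] allI impI)
      fix n :: nat assume n: "n \<ge> 3"
      have "ln (real n) powr (1 + \<gamma>) = ln (real n) * ln (real n) powr \<gamma>"
        using ln1[OF n] by (simp add: powr_add)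
      then have tau: "tau d v \<gamma> C n powr v = C 5 powr v * real n powr (- 1 / 2) * (ln (real n) * ln (real n) powr \<gamma>)"
        using 2 v n tau_powr[OF C5[OF 2] n, of "- 1 / (2 * v)" "1 + \<gamma>"] by (simp add: tau_def)
      have k: "k_seq d v n powr (- v) = real n powr (- 1 / 2)"
        using 2 v by (simp add: k_seq_def powr_powr)
      have "log 2 (k_seq d v n) = ln (real n) / (2 * v * ln 2)"
        using 2 v n by (simp add: k_seq_def log_def ln_powr)
      then have "real (K n) \<le> ln (real n) * (1 / (2 * v * ln 2)) + 1"
        using K_le[OF n] by simp
      also have "\<dots> \<le> ln (real n) * (1 / (2 * v * ln 2) + 1)"
        using ln1[OF n] by (simp add: distrib_left)
      finally have K: "real (K n) \<le> ln (real n) * (1 / (2 * v * ln 2) + 1)" .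
      have "(\<Sum>k<K n. \<rho> ^ k) = real (K n)" using 2 by (simp add: \<rho>_def \<beta>_def)
      then have "transport_rate d v (K n) n \<le> real n powr (- 1 / 2)
          + B * real n powr (- 1 / 2) * (ln (real n) * (1 / (2 * v * ln 2) + 1))"
        unfolding rate[OF n] using lead[OF n] k B K by (intro add_mono mult_left_mono) auto
      also have "\<dots> \<le> real n powr (- 1 / 2) * ln (real n)
          + B * real n powr (- 1 / 2) * (ln (real n) * (1 / (2 * v * ln 2) + 1))"
        using ln1[OF n] by (intro add_right_mono) (simp add: mult_le_cancel_left1)
      finally have le: "transport_rate d v (K n) n \<le> A * (real n powr (- 1 / 2) * ln (real n))"
        by (simp add: A_def algebra_simps)
      show "transport_rate d v (K n) n \<le> (A) / C 5 powr v * ln (real n) powr (- \<gamma>) * tau d v \<gamma> C n powr v"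
        by (rule conclude[OF n C5[OF 2] tau le])
    qed
  next
    case 3
    have \<beta>: "0 < \<beta>" using 3 by (simp add: \<beta>_def)
    have \<rho>: "1 < \<rho>" using \<beta> powr_less_mono[of 0 \<beta> 2] by (simp add: \<rho>_def)
    show ?thesis
    proof (intro exI[of _ "(1 + B * (\<rho> / (\<rho> - 1))) / C 6 powr v"] allI impI)
      fix n :: nat assume n: "n \<ge> 3"
      have tau: "tau d v \<gamma> C n powr v = C 6 powr v * real n powr (- v / real d) * (1 * ln (real n) powr \<gamma>)"
        using 3 v n tau_powr[OF C6[OF 3] n, of "- 1 / real d" \<gamma>] by (simp add: tau_def)
      have k: "k_seq d v n = real n powr (1 / real d)" using 3 by (simp add: k_seq_def)
      have kv: "k_seq d v n powr (- v) = real n powr (- v / real d)"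
        by (simp add: k powr_powr)
      \<comment> \<open>The finest levels dominate. The extra factor \<open>\<rho>\<close> below is
        the price of rounding \<open>K\<close> up.\<close>
      have "(\<Sum>k<K n. \<rho> ^ k) = (\<rho> ^ K n - 1) / (\<rho> - 1)"
        using \<rho> geometric_sum[of \<rho> "K n"] by simp
      also have "\<dots> \<le> \<rho> ^ K n / (\<rho> - 1)"
        using \<rho> by (intro divide_right_mono) auto
      also have "\<rho> ^ K n \<le> \<rho> * real n powr (\<beta> / real d)"
      proof -
        have "\<rho> ^ K n = 2 powr (\<beta> * real (K n))"
          by (simp add: \<rho>_def powr_realpow[symmetric] powr_powr)
        also have "\<dots> \<le> 2 powr (\<beta> * (log 2 (k_seq d v n) + 1))"
          using K_le[OF n] \<beta> by (intro powr_mono mult_left_mono) auto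
        also have "\<dots> = \<rho> * (2 powr log 2 (k_seq d v n)) powr \<beta>"
          by (simp add: \<rho>_def powr_powr powr_add[symmetric] algebra_simps)
        also have "(2 powr log 2 (k_seq d v n)) powr \<beta> = real n powr (\<beta> / real d)"
        proof -
          have "2 powr log 2 (k_seq d v n) = k_seq d v n" using k1[OF n] by simp
          then show ?thesis by (simp add: k powr_powr)
        qed
        finally show ?thesis .
      qed
      finally have geo: "(\<Sum>k<K n. \<rho> ^ k) \<le> \<rho> * real n powr (\<beta> / real d) / (\<rho> - 1)"
        using \<rho> by (simp add: divide_right_mono)
      have "transport_rate d v (K n) n \<le> real n powr (- v / real d)
          + B * real n powr (- 1 / 2) * (\<rho> * real n powr (\<beta> / real d) / (\<rho> - 1))"
        unfolding rate[OF n] using lead[OF n] kv B by (intro add_mono mult_left_mono geo) auto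
      also have "\<dots> = real n powr (- v / real d)
          + B * (\<rho> / (\<rho> - 1)) * (real n powr (- 1 / 2) * real n powr (\<beta> / real d))"
        by simp
      \<comment> \<open>Since \<open>\<beta> / d = 1 / 2 - v / d\<close>, the fluctuation term has
        the same order as the finest cell cost.\<close>
      also have "real n powr (- 1 / 2) * real n powr (\<beta> / real d) = real n powr (- v / real d)"
        using d by (simp add: powr_add[symmetric] \<beta>_def field_simps)
      finally have le: "transport_rate d v (K n) n \<le> (1 + B * (\<rho> / (\<rho> - 1))) * (real n powr (- v / real d) * 1)"
        by (simp add: algebra_simps)
      show "transport_rate d v (K n) n \<le> (1 + B * (\<rho> / (\<rho> - 1))) / C 6 powr v * ln (real n) powr (- \<gamma>) * tau d v \<gamma> C n powr v"
        by (rule conclude[OF n C6[OF 3] tau le])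
    qed
  qed
  then show ?thesis unfolding K_def .
qed

text \<open>The Bochner integral of a non-integrable function is 0, which lies between the bounds as
  well. Hence the posterior probability can be averaged without showing that it is measurable in the
  sample.\<close>

lemma (in prob_space) integral_between:
  fixes f :: "'a \<Rightarrow> real"
  assumes "AE x in M. 0 \<le> f x" "AE x in M. f x \<le> B" "0 \<le> B"
  shows "0 \<le> (\<integral>x. f x \<partial>M) \<and> (\<integral>x. f x \<partial>M) \<le> B"
proof (cases "integrable M f")
  case True
  then show ?thesis
    using assms by (auto intro: integral_nonneg_AE integral_le_const)
next
  case False
  then show ?thesis using assms(3) by (simp add: not_integrable_integral_eq)
qed

theorem theorem2:
  fixes M :: "'w measure" and Y :: "nat \<Rightarrow> 'w \<Rightarrow> real^'d::finite"
    and P0 :: "(real^'d) measure" and p v \<gamma> :: real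
    and \<alpha> :: "nat \<Rightarrow> ('d \<Rightarrow> nat) \<Rightarrow> real" and C :: "nat \<Rightarrow> real"
  defines "d \<equiv> CARD('d)"
  assumes "prob_space M"
    and "prob_space.indep_vars M (\<lambda>_. borel) Y UNIV"
    and "\<And>t. distr M borel (Y t) = P0"
    and "P0 \<in> Pd"
    and "1 \<le> p" and "1 \<le> v"
    and "\<And>n j. j \<in> idx (b_seq d v n) \<Longrightarrow> \<alpha> (b_seq d v n) j > 0"
    and "\<gamma> > 1"
    and "real d < 2 * v \<Longrightarrow> C 1 \<ge> 2 powr (real d / 2 - v) / (1 - 2 powr (real d / 2 - v))"
    and "real d = 2 * v \<Longrightarrow> C 2 \<ge> 2 / (real d * ln 2)"
    and "real d > 2 * v \<Longrightarrow> C 3 \<ge> 2 powr (2 * (real d / 2 - v)) / (2 powr (real d / 2 - v) - 1)"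
    and "real d < 2 * v \<Longrightarrow> C 4 > 1/2 * C 1 powr (1/v) * 2 powr (1/v) * real d powr (1/p)"
    and "real d = 2 * v \<Longrightarrow> C 5 > 1/2 * C 2 powr (1/v) * 2 powr (1/v) * real d powr (1/p)"
    and "real d > 2 * v \<Longrightarrow> C 6 > 1/2 * C 3 powr (1/v) * 2 powr (1/v) * real d powr (1/p)"
  shows "(\<lambda>n. \<integral>\<omega>. post_prob p v (\<alpha> (b_seq d v n)) (b_seq d v n) (\<lambda>t. Y t \<omega>) n
                   (tau d v \<gamma> C n) \<partial>M) \<longlonglongrightarrow> 0"
proof -
  interpret prob_space M by fact
  have d: "0 < d" by (simp add: d_def)
  have v: "0 < v" using \<open>1 \<le> v\<close> by simp
  \<comment> \<open>\<open>powr\<close> is nonnegative for every base, so the strict lower bounds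
    make \<open>C 4\<close>, \<open>C 5\<close> and \<open>C 6\<close> positive in their respective
    cases.\<close>
  have half_nonneg: "0 \<le> 1/2 * x powr (1/v) * 2 powr (1/v) * real d powr (1/p)" for x by simp
  have C: "real d < 2 * v \<Longrightarrow> 0 < C 4" "real d = 2 * v \<Longrightarrow> 0 < C 5" "2 * v < real d \<Longrightarrow> 0 < C 6"
    using assms(13-15) half_nonneg order_le_less_trans by blast+
  obtain c where c: "\<And>n. n \<ge> 3 \<Longrightarrow> transport_rate d v (nat \<lceil>log 2 (k_seq d v n)\<rceil>) n
      \<le> c * ln (real n) powr (- \<gamma>) * tau d v \<gamma> C n powr v"
    using transport_rate_le_tau[where C = C, OF d v C, of \<gamma>] by blast
  have Y: "Y t \<in> borel_measurable M" for t
    using assms(3) by (auto simp: indep_vars_def)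
  have "AE \<omega> in M. Y t \<omega> \<in> unit_cube" for t
  proof -
    have "(unit_cube :: (real^'d) set) \<in> sets borel" unfolding unit_cube_def by measurable
    then have "emeasure M (Y t -` unit_cube \<inter> space M) = emeasure P0 unit_cube"
      using emeasure_distr[OF Y, of unit_cube t] assms(4)[of t] by simp
    also have "\<dots> = 1" using \<open>P0 \<in> Pd\<close> by (simp add: Pd_def)
    finally have "prob (Y t -` unit_cube \<inter> space M) = 1" by (simp add: measure_def)
    then have "AE \<omega> in M. \<omega> \<in> Y t -` unit_cube \<inter> space M"
      by (rule AE_prob_1)
    then show ?thesis by eventually_elim auto
  qed
  then have cube: "AE \<omega> in M. \<forall>t. Y t \<omega> \<in> unit_cube" by (subst AE_all_countable) auto
  define D where "D = (real d powr (1 / p)) powr v"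
  \<comment> \<open>Dividing by \<open>tau\<close> to the power \<open>v\<close> leaves only the
    surplus \<open>ln n powr (- \<gamma>)\<close>; nothing in \<open>u\<close> depends on the
    sample.\<close>
  define u where "u n = 4 / real n + D * (c * ln (real n) powr (- \<gamma>))" for n
  have u: "post_prob p v (\<alpha> (b_seq d v n)) (b_seq d v n) y n (tau d v \<gamma> C n) \<le> u n"
    if n: "n \<ge> 3" and y: "\<forall>t. y t \<in> unit_cube" for n and y :: "nat \<Rightarrow> real^'d"
  proof -
    define K where "K = nat \<lceil>log 2 (k_seq d v n)\<rceil>"
    have b: "b_seq d v n = 2 ^ K" by (simp add: b_seq_def K_def)
    have "0 < ln (real n)" using n by simp
    then have \<tau>: "0 < tau d v \<gamma> C n"
      using C n by (auto simp: tau_def)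
    have "post_prob p v (\<alpha> (2 ^ K)) (2 ^ K) y n (tau d v \<gamma> C n)
        \<le> 4 / real n + D * transport_rate d v K n / tau d v \<gamma> C n powr v"
      unfolding D_def d_def
      by (rule post_prob_le) (use y n v \<open>1 \<le> p\<close> \<tau> assms(8)[of _ n] in \<open>auto simp: b d_def[symmetric]\<close>)
    also have "\<dots> \<le> 4 / real n + D * (c * ln (real n) powr (- \<gamma>) * tau d v \<gamma> C n powr v) / tau d v \<gamma> C n powr v"
      using c[OF n] by (intro add_left_mono divide_right_mono mult_left_mono) (auto simp: K_def D_def)
    also have "\<dots> = u n" using \<tau> by (simp add: u_def)
    finally show ?thesis by (simp add: b)
  qed
  have post_nonneg: "0 \<le> post_prob p v a b y n s" for a b n s and y :: "nat \<Rightarrow> real^'d"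
    by (simp add: post_prob_def Let_def)
  have lim: "u \<longlonglongrightarrow> 0"
  proof -
    have "filterlim (\<lambda>n. ln (real n)) at_top sequentially"
      by (rule filterlim_compose[OF ln_at_top filterlim_real_sequentially])
    then have "(\<lambda>n. ln (real n) powr (- \<gamma>)) \<longlonglongrightarrow> 0"
      using \<open>\<gamma> > 1\<close> by (intro tendsto_neg_powr) auto
    then have "(\<lambda>n. D * (c * ln (real n) powr (- \<gamma>))) \<longlonglongrightarrow> 0"
      by (intro tendsto_mult_right_zero)
    moreover have "(\<lambda>n. 4 / real n) \<longlonglongrightarrow> 0"
      by (rule lim_const_over_n)
    ultimately show ?thesis unfolding u_def using tendsto_add by fastforce
  qed
  have "\<forall>\<^sub>F n in sequentially. 0 \<le> (\<integral>\<omega>. post_prob p v (\<alpha> (b_seq d v n)) (b_seq d v n) (\<lambda>t. Y t \<omega>) n (tau d v \<gamma> C n) \<partial>M)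
      \<and> (\<integral>\<omega>. post_prob p v (\<alpha> (b_seq d v n)) (b_seq d v n) (\<lambda>t. Y t \<omega>) n (tau d v \<gamma> C n) \<partial>M) \<le> u n"
    using eventually_ge_at_top[of 3]
  proof eventually_elim
    case (elim n)
    have bound: "AE \<omega> in M. post_prob p v (\<alpha> (b_seq d v n)) (b_seq d v n) (\<lambda>t. Y t \<omega>) n (tau d v \<gamma> C n) \<le> u n"
      using cube by eventually_elim (use u[OF elim] in auto)
    \<comment> \<open>The sign of \<open>c\<close> is not known; the sample path resting at the
      origin, a point of the unit cube, shows that \<open>u n\<close> bounds a probability.\<close>
    have "0 \<le> u n" using u[OF elim, of "\<lambda>_. 0"] post_nonneg by (rule order_trans[rotated]) (simp add: unit_cube_def)
    with bound show ?case by (intro integral_between) (auto simp: post_nonneg)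
  qed
  then show ?thesis
    by (intro tendsto_sandwich[OF _ _ tendsto_const lim]) (auto elim: eventually_mono)
qed

end
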